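(* Let $0<\tau<T$, $a_{+},a_{-}>0$, and let $a\in L^{\infty}(0,T)$ be the stepwise function $a(t)=a_{+}$ for $t\in[0,\tau)$ and $a(t)=-a_{-}$ for $t\in[\tau,T)$. Let $\gamma\in(-\infty,-3]\cup(1,+\infty)$. Then the Neumann boundary value problem ($u'(0)=u'(T)=0$) and the periodic boundary value problem ($u(0)=u(T)$, $u'(0)=u'(T)$) associated with the equation $$u''+a(t)u^{\gamma}=0$$ on $[0,T]$ each have at most one positive solution. Moreover, for each of these two problems, there exists a unique positive solution if and only if $\gamma\cdot\int_{0}^{T}a(t)\,\mathrm{d}t<0$.
   Context: A positive solution of $u''+a(t)u^{\gamma}=0$ is a function $u\colon[0,T]\to(0,+\infty)$ of class $\mathcal{C}^{1}$ such that $u'$ is absolutely continuous and the equation is satisfied for almost every $t\in[0,T]$ (in addition to the prescribed boundary conditions). *)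

theory Defs
  imports "HOL-Analysis.Analysis"
begin

text \<open>
  Absolute continuity of a function of one real variable. The family \<open>d\<close> is a finite collection
  of non-overlapping compact intervals \<open>K = {Inf K..Sup K}\<close> contained in \<open>S\<close>.
  (The library constant \<^const>\<open>absolutely_continuous\<close> is about measures.)
\<close>

definition abs_continuous_on :: "real set \<Rightarrow> (real \<Rightarrow> real) \<Rightarrow> bool" where
  "abs_continuous_on S f \<longleftrightarrow>
    (\<forall>\<epsilon>>0. \<exists>\<delta>>0. \<forall>d. d division_of (\<Union>d) \<and> \<Union>d \<subseteq> S \<and> (\<Sum>K\<in>d. Sup K - Inf K) < \<delta>
      \<longrightarrow> (\<Sum>K\<in>d. \<bar>f (Sup K) - f (Inf K)\<bar>) < \<epsilon>)"

text \<open>The derivative of a function on \<open>[0,T]\<close>, one-sided at the two endpoints.\<close>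

definition deriv_upto :: "real \<Rightarrow> (real \<Rightarrow> real) \<Rightarrow> real \<Rightarrow> real" where
  "deriv_upto T u t = vector_derivative u (at t within {0..T})"

text \<open>
  Positive solutions of \<open>u'' + a(t) u\<^sup>\<gamma> = 0\<close> on \<open>[0,T]\<close>. A function \<open>u : [0,T] \<rightarrow> (0,\<infinity>)\<close> is
  represented by its extension with value \<^const>\<open>undefined\<close> outside \<open>[0,T]\<close>, so that equality of
  solutions is equality on \<open>[0,T]\<close>.
\<close>

definition positive_solution ::
    "real \<Rightarrow> (real \<Rightarrow> real) \<Rightarrow> real \<Rightarrow> (real \<Rightarrow> real) \<Rightarrow> bool" where
  "positive_solution T a \<gamma> u \<longleftrightarrow>
     u \<in> {0..T} \<rightarrow>\<^sub>E {0<..} \<and>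
     u differentiable_on {0..T} \<and>
     continuous_on {0..T} (deriv_upto T u) \<and>
     abs_continuous_on {0..T} (deriv_upto T u) \<and>
     (AE t in lebesgue_on {0..T}.
        deriv_upto T u differentiable (at t within {0..T}) \<and>
        deriv_upto T (deriv_upto T u) t + a t * u t powr \<gamma> = 0)"

definition neumann_solution ::
    "real \<Rightarrow> (real \<Rightarrow> real) \<Rightarrow> real \<Rightarrow> (real \<Rightarrow> real) \<Rightarrow> bool" where
  "neumann_solution T a \<gamma> u \<longleftrightarrow>
     positive_solution T a \<gamma> u \<and> deriv_upto T u 0 = 0 \<and> deriv_upto T u T = 0"

definition periodic_solution ::
    "real \<Rightarrow> (real \<Rightarrow> real) \<Rightarrow> real \<Rightarrow> (real \<Rightarrow> real) \<Rightarrow> bool" where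
  "periodic_solution T a \<gamma> u \<longleftrightarrow>
     positive_solution T a \<gamma> u \<and> u 0 = u T \<and> deriv_upto T u 0 = deriv_upto T u T"

end

theory Submission
  imports Defs
begin

text \<open>
  Write \<open>\<gamma> = 2 c - 1\<close>, so that \<open>c\<close> has the sign of \<open>\<gamma>\<close> in the range considered. On each of the intervals
  \<open>[0,\<tau>]\<close> and \<open>[\<tau>,T]\<close> the equation is autonomous, \<open>y'' = - b y\<^sup>\<gamma>\<close> with \<open>b = a\<^sub>+\<close> or \<open>b = - a\<^sub>-\<close>. Consider
  an arc, that is, a solution with \<open>y'(0) = 0\<close>, and its slope variable \<open>\<rho> = - y' / (b y\<^sup>c)\<close>. Conservation
  of energy says that \<open>y\<^sup>2\<^sup>c (1 + c b \<rho>\<^sup>2)\<close> is constant, and the equation becomes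
  \<open>\<rho>' = y\<^sup>c\<^sup>-\<^sup>1 (1 + c b \<rho>\<^sup>2)\<close>. Eliminating \<open>y\<close> and separating variables, an arc of length \<open>L\<close> satisfies
  the time map (\<open>power_arc_time_map\<close>)

  \<open>L y(L)\<^sup>c\<^sup>-\<^sup>1 = \<rho> \<Psi>(c b \<rho>\<^sup>2)\<close>, where \<open>\<rho>\<close> is taken at \<open>L\<close>,
  \<open>\<Psi>(x) = \<integral> ((1 + x s\<^sup>2) / (1 + x))\<^sup>\<beta> / (1 + x s\<^sup>2) ds\<close> over \<open>[0,1]\<close>, and \<open>\<beta> = (c - 1) / (2 c) > 0\<close>.

  The integrand decreases in \<open>x\<close> for each \<open>s\<close>. So \<open>\<Psi>\<close> decreases strictly on \<open>(-1,\<infinity>)\<close>, with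
  \<open>\<Psi>(0) = 1\<close> and limit \<open>\<infinity>\<close> at \<open>-1\<close> (\<open>time_ratio_strict_antimono\<close>, \<open>time_ratio_unbounded\<close>).

  A Neumann solution consists of an arc on \<open>[0,\<tau>]\<close> and a reversed arc on \<open>[\<tau>,T]\<close>. A periodic solution
  takes equal values at \<open>0\<close>, \<open>\<tau>\<close> and \<open>T\<close> by conservation of energy, so it is symmetric about the
  midpoints of both intervals (\<open>periodic_solution_symmetric\<close>) and is given by two arcs of half the
  lengths. In both cases there are two arcs, of lengths \<open>l1\<close> and \<open>l2\<close>, with the same value and opposite
  slopes at their ends. With \<open>R = \<bar>u'(\<tau>)\<bar> / u(\<tau>)\<^sup>c\<close> and \<open>\<xi> = c R\<^sup>2\<close>, dividing the two time maps gives

  \<open>a\<^sub>+ l1 \<Psi>(- \<xi> / a\<^sub>-) - a\<^sub>- l2 \<Psi>(\<xi> / a\<^sub>+) = 0\<close>.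

  The left-hand side increases strictly in \<open>\<xi>\<close>, so it has at most one root, and \<open>\<xi>\<close> determines the
  solution (\<open>junction_unique\<close>). It runs from \<open>-\<infinity>\<close> to \<open>\<infinity>\<close> on \<open>(- a\<^sub>+, a\<^sub>-)\<close>, so there is a root. But
  \<open>\<xi> = c R\<^sup>2\<close> must have the sign of \<open>c\<close>, that is, of \<open>\<gamma>\<close>, and this happens exactly if the value at
  \<open>\<xi> = 0\<close>, which is \<open>a\<^sub>+ l1 - a\<^sub>- l2\<close>, has the opposite sign (\<open>junction_sign\<close>, \<open>junction_exists\<close>). This
  value is the integral of \<open>a\<close>, or half of it in the periodic case.

  Solutions in the almost everywhere sense are classical on both intervals by the fundamental
  theorem of calculus for absolutely continuous functions (\<open>has_integral_abs_continuous\<close>).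
\<close>

section \<open>Absolutely continuous functions\<close>
lemma abs_continuous_on_subset:
  "abs_continuous_on S f \<Longrightarrow> R \<subseteq> S \<Longrightarrow> abs_continuous_on R f"
  unfolding abs_continuous_on_def by (meson order_trans)

text \<open>
  The fundamental theorem of calculus for absolutely continuous functions, in gauge form. The gauge
  at a point outside \<open>N\<close> comes from the derivative there; the gauge at a point of \<open>N\<close> keeps the
  interval inside an open set \<open>U \<supseteq> N\<close> of small measure. In a fine division the intervals tagged
  in \<open>N\<close> then have small total length, so absolute continuity makes their contribution to
  \<open>f b - f a\<close> small, while the other intervals contribute the usual Riemann sum error.
\<close>
lemma has_integral_abs_continuous:
  fixes f f' :: "real \<Rightarrow> real"
  assumes "a \<le> b" and ac: "abs_continuous_on {a..b} f" and "negligible N"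
    and der: "\<And>x. x \<in> {a..b} - N \<Longrightarrow> (f has_real_derivative f' x) (at x within {a..b})"
  shows "(f' has_integral (f b - f a)) {a..b}"
proof -
  \<comment> \<open>Tags in \<open>N\<close> should contribute nothing to the Riemann sum.\<close>
  define g where "g = (\<lambda>x. if x \<in> N then 0 else f' x)"
  have "(g has_integral (f b - f a)) {a..b}"
    unfolding has_integral_real
  proof (intro allI impI)
    fix e :: real
    assume "e > 0"
    define \<eta> where "\<eta> = e / (2 * (b - a + 1))"
    have "\<eta> > 0" using \<open>e > 0\<close> \<open>a \<le> b\<close> by (simp add: \<eta>_def)
    have \<eta>e: "\<eta> * (b - a) \<le> e / 2"
    proof -
      have "\<eta> * (b - a) \<le> \<eta> * (b - a + 1)" using \<open>\<eta> > 0\<close> by simp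
      also have "\<dots> = e / 2" using \<open>a \<le> b\<close> by (simp add: \<eta>_def field_simps)
      finally show ?thesis .
    qed
    obtain \<delta> where "\<delta> > 0" and \<delta>: "\<And>d. d division_of (\<Union>d) \<Longrightarrow> \<Union>d \<subseteq> {a..b} \<Longrightarrow>
        (\<Sum>K\<in>d. Sup K - Inf K) < \<delta> \<Longrightarrow> (\<Sum>K\<in>d. \<bar>f (Sup K) - f (Inf K)\<bar>) < e / 2"
      using ac \<open>e > 0\<close> unfolding abs_continuous_on_def by (meson half_gt_zero)
    have N: "N \<in> null_sets lebesgue" using \<open>negligible N\<close> negligible_iff_null_sets by blast
    obtain U where "open U" "N \<subseteq> U" and U: "emeasure lebesgue (U - N) < ennreal \<delta>"
      by (rule sets_lebesgue_outer_open[OF null_setsD2[OF N] \<open>\<delta> > 0\<close>])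
    have "U \<in> sets lebesgue" using \<open>open U\<close> by (simp add: borel_open sets_completionI_sets)
    have emU: "emeasure lebesgue U < ennreal \<delta>"
      using emeasure_Diff_null_set[OF N \<open>U \<in> sets lebesgue\<close>] U by simp
    have Ulm: "U \<in> lmeasurable"
      using emU \<open>U \<in> sets lebesgue\<close> by (intro fmeasurableI) (auto simp: less_top[symmetric] intro: order_less_trans)
    have mU: "measure lebesgue U < \<delta>"
      using emU Ulm \<open>\<delta> > 0\<close> by (simp add: emeasure_eq_measure2 ennreal_less_iff)
    have "\<exists>r>0. (x \<in> {a..b} - N \<longrightarrow> (\<forall>y\<in>{a..b}. \<bar>y - x\<bar> < r \<longrightarrow> \<bar>f y - f x - (y - x) * f' x\<bar> \<le> \<eta> * \<bar>y - x\<bar>))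
        \<and> (x \<in> N \<longrightarrow> ball x r \<subseteq> U)" for x
    proof (cases "x \<in> N")
      case True
      then show ?thesis using \<open>open U\<close> \<open>N \<subseteq> U\<close> by (metis DiffD2 open_contains_ball subsetD)
    next
      case False
      show ?thesis
      proof (cases "x \<in> {a..b}")
        case True
        with False der[of x] \<open>\<eta> > 0\<close> False show ?thesis
          unfolding has_field_derivative_def has_derivative_within_alt
          by (simp add: mult.commute)
      qed (use False in \<open>auto intro: exI[of _ 1]\<close>)
    qed
    then obtain r where r0: "\<And>x. r x > 0"
      and r: "\<And>x y. x \<in> {a..b} - N \<Longrightarrow> y \<in> {a..b} \<Longrightarrow> \<bar>y - x\<bar> < r x \<Longrightarrow>
                 \<bar>f y - f x - (y - x) * f' x\<bar> \<le> \<eta> * \<bar>y - x\<bar>"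
      and rN: "\<And>x. x \<in> N \<Longrightarrow> ball x (r x) \<subseteq> U"
      by metis
    show "\<exists>\<gamma>. gauge \<gamma> \<and> (\<forall>\<D>. \<D> tagged_division_of {a..b} \<and> \<gamma> fine \<D> \<longrightarrow>
            norm ((\<Sum>(x,K)\<in>\<D>. measure lborel K *\<^sub>R g x) - (f b - f a)) < e)"
    proof (intro exI conjI allI impI)
      show "gauge (\<lambda>x. ball x (r x))" using r0 gauge_ball_dependent by blast
    next
      fix p assume "p tagged_division_of {a..b} \<and> (\<lambda>x. ball x (r x)) fine p"
      then have p: "p tagged_division_of {a..b}" and fine: "(\<lambda>x. ball x (r x)) fine p" by auto
      note p' = tagged_division_ofD[OF p]
      have fin: "finite p" by (rule p'(1))
      define pN where "pN = {xK \<in> p. fst xK \<in> N}"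
      have pN: "pN \<subseteq> p" by (auto simp: pN_def)
      define h where "h = (\<lambda>K. if K = {} then 0 else \<bar>f (Sup K) - f (Inf K)\<bar>)"
      have int: "\<exists>u v. K = {u..v} \<and> u \<le> v \<and> u \<in> {a..b} \<and> v \<in> {a..b} \<and> x \<in> {u..v}" if "(x, K) \<in> p" for x K
      proof -
        obtain u v where "K = cbox u v" using p'(4)[OF \<open>(x, K) \<in> p\<close>] by blast
        moreover have "x \<in> K" "K \<subseteq> {a..b}" using p'(2,3)[OF that] by auto
        ultimately show ?thesis
          by (intro exI[of _ u] exI[of _ v]) auto
      qed
      have part: "pN tagged_partial_division_of {a..b}"
        by (rule tagged_partial_division_subset[OF _ pN]) (use p in \<open>simp add: tagged_division_of_def\<close>)
      have div: "(snd ` pN) division_of \<Union>(snd ` pN)"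
        by (rule partial_division_of_tagged_division[OF part])
      have tagN: "pN tagged_division_of \<Union>(snd ` pN)"
        by (rule tagged_partial_division_of_Union_self[OF part])
      have UN: "\<Union>(snd ` pN) \<subseteq> U"
      proof clarify
        fix w x K assume "w \<in> snd (x, K)" "(x, K) \<in> pN"
        then have "w \<in> ball x (r x)" "x \<in> N" using fineD[OF fine, of x K] by (auto simp: pN_def)
        then show "w \<in> U" using rN by blast
      qed
      have len: "(\<Sum>K\<in>snd ` pN. Sup K - Inf K) < \<delta>"
      proof -
        have "(\<Sum>K\<in>snd ` pN. Sup K - Inf K) = (\<Sum>K\<in>snd ` pN. measure lebesgue K)"
        proof (rule sum.cong[OF refl])
          fix K assume "K \<in> snd ` pN"
          then obtain x where "(x, K) \<in> p" using pN by force
          then obtain u v where "K = {u..v}" "u \<le> v" using int by blast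
          then show "Sup K - Inf K = measure lebesgue K" by simp
        qed
        also have "\<dots> = measure lebesgue (\<Union>(snd ` pN))"
          using content_division[OF div] by simp
        also have "\<dots> \<le> measure lebesgue U"
          using UN Ulm div by (intro measure_mono_fmeasurable) (auto dest: lmeasurable_division)
        finally show ?thesis using mU by simp
      qed
      have "(\<Sum>(x,K)\<in>pN. h K) = (\<Sum>K\<in>snd ` pN. h K)"
      proof (rule sum.over_tagged_division_lemma[OF tagN])
        fix u v :: real assume "box u v = {}"
        then show "h (cbox u v) = 0" by (cases "u = v") (auto simp: h_def)
      qed
      also have "\<dots> = (\<Sum>K\<in>snd ` pN. \<bar>f (Sup K) - f (Inf K)\<bar>)"
      proof (rule sum.cong[OF refl])
        fix K assume "K \<in> snd ` pN"
        then show "h K = \<bar>f (Sup K) - f (Inf K)\<bar>" using div by (auto simp: h_def division_of_def)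
      qed
      also have "\<dots> < e / 2"
      proof (rule \<delta>[OF div _ len])
        show "\<Union>(snd ` pN) \<subseteq> {a..b}"
        proof clarify
          fix w x K assume "w \<in> snd (x, K)" "(x, K) \<in> pN"
          then show "w \<in> {a..b}" using subsetD[OF p'(3)[of x K], of w] subsetD[OF pN] by simp
        qed
      qed
      finally have bad: "(\<Sum>(x,K)\<in>pN. h K) < e / 2" .
      have good: "(\<Sum>(x,K)\<in>p - pN. \<bar>measure lborel K * g x - (f (Sup K) - f (Inf K))\<bar>) \<le> e / 2"
      proof -
        have "(\<Sum>(x,K)\<in>p - pN. \<bar>measure lborel K * g x - (f (Sup K) - f (Inf K))\<bar>)
            \<le> (\<Sum>(x,K)\<in>p - pN. \<eta> * (Sup K - Inf K))"
        proof (rule sum_mono, clarsimp)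
          fix x K assume xK: "(x, K) \<in> p" "(x, K) \<notin> pN"
          then have "x \<notin> N" by (auto simp: pN_def)
          obtain u v where uv: "K = {u..v}" "u \<le> v" "u \<in> {a..b}" "v \<in> {a..b}" "x \<in> {u..v}"
            using int[OF xK(1)] by blast
          have "x \<in> {a..b} - N" using uv \<open>x \<notin> N\<close> by auto
          have "u \<in> K" "v \<in> K" using uv by auto
          then have "u \<in> ball x (r x)" "v \<in> ball x (r x)"
            using subsetD[OF fineD[OF fine xK(1)]] by blast+
          then have "\<bar>u - x\<bar> < r x" "\<bar>v - x\<bar> < r x" by (auto simp: dist_real_def)
          then have "\<bar>f u - f x - (u - x) * f' x\<bar> \<le> \<eta> * \<bar>u - x\<bar>"
                    "\<bar>f v - f x - (v - x) * f' x\<bar> \<le> \<eta> * \<bar>v - x\<bar>"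
            using r[OF \<open>x \<in> {a..b} - N\<close> uv(3)] r[OF \<open>x \<in> {a..b} - N\<close> uv(4)] by blast+
          moreover have "\<bar>u - x\<bar> = x - u" "\<bar>v - x\<bar> = v - x" using uv by auto
          ultimately have "\<bar>(v - u) * f' x - (f v - f u)\<bar> \<le> \<eta> * (v - u)"
            by (simp add: abs_le_iff algebra_simps)
          then show "\<bar>measure lborel K * g x - (f (Sup K) - f (Inf K))\<bar> \<le> \<eta> * (Sup K - Inf K)"
            using uv \<open>x \<notin> N\<close> by (simp add: g_def)
        qed
        also have "\<dots> \<le> (\<Sum>(x,K)\<in>p. \<eta> * (Sup K - Inf K))"
        proof (rule sum_mono2[OF fin], blast)
          fix xK assume "xK \<in> p - (p - pN)"
          then obtain x K where xK: "xK = (x, K)" "(x, K) \<in> p" by (cases xK) auto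
          then obtain u v where "K = {u..v}" "u \<le> v" using int by blast
          then show "0 \<le> (case xK of (x, K) \<Rightarrow> \<eta> * (Sup K - Inf K))"
            using \<open>\<eta> > 0\<close> xK by simp
        qed
        also have "\<dots> = \<eta> * (\<Sum>(x,K)\<in>p. Sup K - Inf K)"
          by (simp add: sum_distrib_left case_prod_beta)
        also have "(\<Sum>(x,K)\<in>p. Sup K - Inf K) = b - a"
          using additive_tagged_division_1[OF \<open>a \<le> b\<close> p, of "\<lambda>x. x"] by simp
        finally show ?thesis using \<eta>e by linarith
      qed
      have "norm ((\<Sum>(x,K)\<in>p. measure lborel K *\<^sub>R g x) - (f b - f a))
          = \<bar>\<Sum>(x,K)\<in>p. measure lborel K * g x - (f (Sup K) - f (Inf K))\<bar>"
        using additive_tagged_division_1[OF \<open>a \<le> b\<close> p, of f]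
        by (simp add: sum_subtractf case_prod_beta)
      also have "\<dots> \<le> (\<Sum>(x,K)\<in>p. \<bar>measure lborel K * g x - (f (Sup K) - f (Inf K))\<bar>)"
        by (rule order_trans[OF sum_abs]) (simp add: case_prod_beta)
      also have "\<dots> = (\<Sum>(x,K)\<in>p - pN. \<bar>measure lborel K * g x - (f (Sup K) - f (Inf K))\<bar>)
                     + (\<Sum>(x,K)\<in>pN. \<bar>measure lborel K * g x - (f (Sup K) - f (Inf K))\<bar>)"
        by (rule sum.subset_diff[OF pN fin])
      also have "(\<Sum>(x,K)\<in>pN. \<bar>measure lborel K * g x - (f (Sup K) - f (Inf K))\<bar>) = (\<Sum>(x,K)\<in>pN. h K)"
      proof (rule sum.cong[OF refl], clarify)
        fix x K assume "(x, K) \<in> pN"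
        then have "x \<in> N" "x \<in> K" using p'(2) by (auto simp: pN_def)
        then show "\<bar>measure lborel K * g x - (f (Sup K) - f (Inf K))\<bar> = h K"
          by (auto simp: g_def h_def)
      qed
      finally show "norm ((\<Sum>(x,K)\<in>p. measure lborel K *\<^sub>R g x) - (f b - f a)) < e"
        using good bad by linarith
    qed
  qed
  then show ?thesis
    by (rule has_integral_spike[OF \<open>negligible N\<close>, rotated]) (simp add: g_def)
qed

lemma Lipschitz_imp_abs_continuous_on:
  fixes f :: "real \<Rightarrow> real"
  assumes lip: "\<And>x y. x \<in> S \<Longrightarrow> y \<in> S \<Longrightarrow> \<bar>f x - f y\<bar> \<le> M * \<bar>x - y\<bar>"
  shows "abs_continuous_on S f"
  unfolding abs_continuous_on_def
proof (intro allI impI)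
  fix e :: real assume "e > 0"
  define M' where "M' = \<bar>M\<bar> + 1"
  have "M' > 0" by (simp add: M'_def)
  show "\<exists>\<delta>>0. \<forall>d. d division_of (\<Union>d) \<and> \<Union>d \<subseteq> S \<and> (\<Sum>K\<in>d. Sup K - Inf K) < \<delta>
      \<longrightarrow> (\<Sum>K\<in>d. \<bar>f (Sup K) - f (Inf K)\<bar>) < e"
  proof (intro exI[of _ "e / M'"] conjI allI impI)
    show "e / M' > 0" using \<open>e > 0\<close> \<open>M' > 0\<close> by simp
    fix d assume d: "d division_of (\<Union>d) \<and> \<Union>d \<subseteq> S \<and> (\<Sum>K\<in>d. Sup K - Inf K) < e / M'"
    have "(\<Sum>K\<in>d. \<bar>f (Sup K) - f (Inf K)\<bar>) \<le> (\<Sum>K\<in>d. M' * (Sup K - Inf K))"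
    proof (rule sum_mono)
      fix K assume "K \<in> d"
      then have "K \<noteq> {}" "K \<subseteq> S" "\<exists>u v. K = cbox u v" using d by (auto simp: division_of_def)
      then obtain u v where uv: "K = {u..v}" "u \<le> v" "u \<in> S" "v \<in> S" by (auto; fastforce)
      have "\<bar>f v - f u\<bar> \<le> M * (v - u)" using lip[of v u] uv by simp
      also have "\<dots> \<le> M' * (v - u)" using uv by (intro mult_right_mono) (auto simp: M'_def)
      finally show "\<bar>f (Sup K) - f (Inf K)\<bar> \<le> M' * (Sup K - Inf K)" using uv by simp
    qed
    also have "\<dots> = M' * (\<Sum>K\<in>d. Sup K - Inf K)" by (simp add: sum_distrib_left)
    also have "\<dots> < e" using d \<open>M' > 0\<close> by (simp add: field_simps)
    finally show "(\<Sum>K\<in>d. \<bar>f (Sup K) - f (Inf K)\<bar>) < e" .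
  qed
qed

section \<open>Classical solution arcs\<close>
text \<open>
  A classical solution \<open>y\<close>, with derivative \<open>z\<close>, of \<open>y'' = - b y\<^sup>\<gamma>\<close> on \<open>[p,q]\<close>. The exponent is
  parametrised as \<open>\<gamma> = 2 c - 1\<close>, because the energy is then a combination of \<open>z\<^sup>2\<close> and \<open>y\<close> to the
  power \<open>2 c\<close>, that is, a quadratic form in \<open>z\<close> and \<open>y powr c\<close>. The sign of \<open>b\<close> is arbitrary, so
  that one notion covers the concave and the convex regime.
\<close>
definition power_arc :: "real \<Rightarrow> real \<Rightarrow> real \<Rightarrow> real \<Rightarrow> (real \<Rightarrow> real) \<Rightarrow> (real \<Rightarrow> real) \<Rightarrow> bool" where
  "power_arc c b p q y z \<longleftrightarrow> (\<forall>t\<in>{p..q}. y t > 0 \<and>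
     (y has_real_derivative z t) (at t within {p..q}) \<and>
     (z has_real_derivative - b * y t powr (2 * c - 1)) (at t within {p..q}))"

lemma power_arcD:
  assumes "power_arc c b p q y z" "t \<in> {p..q}"
  shows "y t > 0" "(y has_real_derivative z t) (at t within {p..q})"
    "(z has_real_derivative - b * y t powr (2 * c - 1)) (at t within {p..q})"
  using assms by (auto simp: power_arc_def)

lemma power_arc_subset:
  assumes "power_arc c b p q y z" "p \<le> p'" "q' \<le> q"
  shows "power_arc c b p' q' y z"
  unfolding power_arc_def
proof
  fix t assume "t \<in> {p'..q'}"
  then have "t \<in> {p..q}" "{p'..q'} \<subseteq> {p..q}" using assms by auto
  then show "y t > 0 \<and> (y has_real_derivative z t) (at t within {p'..q'}) \<and>
     (z has_real_derivative - b * y t powr (2 * c - 1)) (at t within {p'..q'})"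
    using power_arcD[OF assms(1)] by (meson DERIV_subset)
qed

lemma power_arc_cong:
  assumes "power_arc c b p q y z"
    and eq: "\<And>t. t \<in> {p..q} \<Longrightarrow> y' t = y t" "\<And>t. t \<in> {p..q} \<Longrightarrow> z' t = z t"
  shows "power_arc c b p q y' z'"
  unfolding power_arc_def
proof
  fix t assume t: "t \<in> {p..q}"
  note d = power_arcD[OF assms(1) t]
  have "(y' has_real_derivative z t) (at t within {p..q})"
    by (rule has_field_derivative_transform_within[OF d(2) zero_less_one t]) (simp add: eq)
  moreover have "(z' has_real_derivative - b * y t powr (2 * c - 1)) (at t within {p..q})"
    by (rule has_field_derivative_transform_within[OF d(3) zero_less_one t]) (simp add: eq)
  ultimately show "y' t > 0 \<and> (y' has_real_derivative z' t) (at t within {p..q}) \<and>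
     (z' has_real_derivative - b * y' t powr (2 * c - 1)) (at t within {p..q})"
    using d(1) eq[OF t] by simp
qed

lemma power_arc_reflect:
  assumes "power_arc c b p q y z"
  shows "power_arc c b (k - q) (k - p) (\<lambda>t. y (k - t)) (\<lambda>t. - z (k - t))"
  unfolding power_arc_def
proof
  fix t assume "t \<in> {k - q..k - p}"
  then have t: "k - t \<in> {p..q}" by auto
  have im: "(\<lambda>s. k - s) ` {k - q..k - p} = {p..q}"
    by (force simp: image_iff intro: bexI[of _ "k - _"])
  have d: "((\<lambda>s. k - s) has_real_derivative -1) (at t within {k - q..k - p})"
    by (auto intro!: derivative_eq_intros)
  have y: "((\<lambda>s. y (k - s)) has_real_derivative z (k - t) * -1) (at t within {k - q..k - p})"
    by (rule DERIV_image_chain[OF _ d, unfolded comp_def]) (use power_arcD[OF assms t] im in simp)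
  have z: "((\<lambda>s. z (k - s)) has_real_derivative (- b * y (k - t) powr (2 * c - 1)) * -1) (at t within {k - q..k - p})"
    by (rule DERIV_image_chain[OF _ d, unfolded comp_def]) (use power_arcD[OF assms t] im in simp)
  show "y (k - t) > 0 \<and> ((\<lambda>t. y (k - t)) has_real_derivative - z (k - t)) (at t within {k - q..k - p}) \<and>
     ((\<lambda>t. - z (k - t)) has_real_derivative - b * y (k - t) powr (2 * c - 1)) (at t within {k - q..k - p})"
    using power_arcD(1)[OF assms t] y DERIV_minus[OF z] by simp
qed

lemma power_arc_translate:
  assumes "power_arc c b p q y z"
  shows "power_arc c b (p + k) (q + k) (\<lambda>t. y (t - k)) (\<lambda>t. z (t - k))"
  using power_arc_reflect[OF power_arc_reflect[OF assms, of 0], of k] by (simp add: algebra_simps)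

text \<open>
  A point of \<open>[p,q]\<close> other than \<open>m\<close> lies in only one of the two parts, hence the conditional premises.
\<close>
lemma has_real_derivative_join:
  fixes f :: "real \<Rightarrow> real"
  assumes "t \<in> {p..m} \<Longrightarrow> (f has_real_derivative D) (at t within {p..m})"
    and "t \<in> {m..q} \<Longrightarrow> (f has_real_derivative D) (at t within {m..q})"
    and "p \<le> m" "m \<le> q"
  shows "(f has_real_derivative D) (at t within {p..q})"
proof -
  \<comment> \<open>A point at positive distance from a closed set has every number as derivative within that set.\<close>
  have triv: "(f has_real_derivative D) (at t within {u..v})" if "t \<notin> {u..v}" for u v
  proof -
    have "\<not> t islimpt {u..v}" using that closed_limpt by blast
    then have "at t within {u..v} = bot" by (simp add: trivial_limit_within)
    then show ?thesis by (simp add: has_field_derivative_iff)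
  qed
  have "(f has_real_derivative D) (at t within {p..m})" "(f has_real_derivative D) (at t within {m..q})"
    using assms triv by blast+
  then have "(f has_real_derivative D) (at t within {p..m} \<union> {m..q})"
    by (simp add: has_field_derivative_iff Lim_within_Un)
  then show ?thesis using assms by (simp add: ivl_disj_un_two_touch)
qed

lemma power_arc_join:
  assumes "power_arc c b p m y z" "power_arc c b m q y z" "p \<le> m" "m \<le> q"
  shows "power_arc c b p q y z"
  unfolding power_arc_def
proof (intro ballI conjI)
  fix t assume t: "t \<in> {p..q}"
  then show "y t > 0" using power_arcD(1)[OF assms(1), of t] power_arcD(1)[OF assms(2), of t] by force
  show "(y has_real_derivative z t) (at t within {p..q})"
    by (rule has_real_derivative_join[OF power_arcD(2)[OF assms(1)] power_arcD(2)[OF assms(2)] assms(3,4)])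
  show "(z has_real_derivative - b * y t powr (2 * c - 1)) (at t within {p..q})"
    by (rule has_real_derivative_join[OF power_arcD(3)[OF assms(1)] power_arcD(3)[OF assms(2)] assms(3,4)])
qed

lemma power_arc_energy:
  assumes "power_arc c b p q y z" "p \<le> q" "c \<noteq> 0"
  shows "(z p)\<^sup>2 + b / c * y p powr (2 * c) = (z q)\<^sup>2 + b / c * y q powr (2 * c)"
proof -
  define E where "E = (\<lambda>t. (z t)\<^sup>2 + b / c * y t powr (2 * c))"
  have "(E has_real_derivative 0) (at t within {p..q})" if "t \<in> {p..q}" for t
  proof -
    note d = power_arcD[OF assms(1) that]
    have "(E has_real_derivative 2 * z t * (- b * y t powr (2 * c - 1))
        + b / c * (2 * c * y t powr (2 * c - 1) * z t)) (at t within {p..q})"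
      unfolding E_def using d by (auto intro!: derivative_eq_intros)
    then show ?thesis using assms by simp
  qed
  then have "E p = E q"
    using has_field_derivative_zero_constant[of "{p..q}" E] assms by force
  then show ?thesis by (simp add: E_def)
qed

section \<open>The monotone function behind the time map\<close>
text \<open>
  The function \<open>\<Psi>\<close> of the introduction. It relates the duration of an arc to the slope at its end
  (\<open>power_arc_time_map\<close>).
\<close>
definition time_ratio :: "real \<Rightarrow> real \<Rightarrow> real" where
  "time_ratio \<beta> x = integral {0..1} (\<lambda>s. (1 + x) powr (-\<beta>) * (1 + x * s\<^sup>2) powr (\<beta> - 1))"

text \<open>
  \<open>1 + x s\<^sup>2\<close> is the convex combination of \<open>1\<close> and \<open>1 + x\<close> with weight \<open>s\<^sup>2\<close>.
\<close>
lemma one_plus_scaled_square_pos: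
  fixes x s :: real
  assumes "x > -1" "\<bar>s\<bar> \<le> 1"
  shows "1 + x * s\<^sup>2 > 0"
proof -
  have "0 \<le> s\<^sup>2" "s\<^sup>2 \<le> 1" using assms(2) by (auto simp: abs_square_le_1)
  have "s\<^sup>2 * (1 + x) \<ge> 0" using assms by simp
  then have "1 + x * s\<^sup>2 \<ge> 1 - s\<^sup>2" by (simp add: algebra_simps)
  show ?thesis
  proof (cases "s\<^sup>2 = 1")
    case False
    then show ?thesis using \<open>1 + x * s\<^sup>2 \<ge> 1 - s\<^sup>2\<close> \<open>s\<^sup>2 \<le> 1\<close> by linarith
  qed (use assms in simp)
qed

lemma continuous_time_integrand:
  assumes "x > -1"
  shows "continuous_on {0..1} (\<lambda>s::real. (1 + x) powr (-\<beta>) * (1 + x * s\<^sup>2) powr (\<beta> - 1))"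
proof -
  have "1 + x * s\<^sup>2 \<noteq> 0" if "s \<in> {0..1}" for s
    using one_plus_scaled_square_pos[of x s] assms that by simp
  then show ?thesis by (intro continuous_intros) auto
qed

lemma time_ratio_0 [simp]: "time_ratio \<beta> 0 = 1"
  by (simp add: time_ratio_def)

text \<open>
  For each fixed \<open>s\<close> in \<open>(0,1)\<close> the integrand can be written as
  \<open>((1 + x s\<^sup>2) / (1 + x))\<^sup>\<beta> / (1 + x s\<^sup>2)\<close>. Both the base of the power and the
  last factor decrease strictly in \<open>x\<close>. All uniqueness statements below rest on this monotonicity.
\<close>
lemma time_ratio_strict_antimono:
  assumes "\<beta> > 0" "-1 < x" "x < y"
  shows "time_ratio \<beta> y < time_ratio \<beta> x"
  unfolding time_ratio_def
proof (rule integral_less_real)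
  fix s :: real assume "s \<in> {0<..<1}"
  then have s: "0 < s\<^sup>2" "s\<^sup>2 < 1" by (auto simp: power_less_one_iff)
  have pos: "1 + x * s\<^sup>2 > 0" "1 + y * s\<^sup>2 > 0" "1 + x > 0" "1 + y > 0"
    using one_plus_scaled_square_pos[of x s] one_plus_scaled_square_pos[of y s] assms \<open>s \<in> _\<close> by auto
  have eq: "(1 + z) powr (-\<beta>) * (1 + z * s\<^sup>2) powr (\<beta> - 1)
      = ((1 + z * s\<^sup>2) / (1 + z)) powr \<beta> / (1 + z * s\<^sup>2)" if "1 + z > 0" "1 + z * s\<^sup>2 > 0" for z
    using that by (simp add: powr_divide powr_minus powr_diff field_simps)
  have "(y - x) * (1 - s\<^sup>2) > 0" using s assms by simp
  then have "(1 + y * s\<^sup>2) / (1 + y) < (1 + x * s\<^sup>2) / (1 + x)"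
    using pos by (simp add: field_simps)
  then have "((1 + y * s\<^sup>2) / (1 + y)) powr \<beta> < ((1 + x * s\<^sup>2) / (1 + x)) powr \<beta>"
    using pos assms by (intro powr_less_mono2) auto
  moreover have "1 + x * s\<^sup>2 < 1 + y * s\<^sup>2" using s assms by simp
  ultimately have "((1 + y * s\<^sup>2) / (1 + y)) powr \<beta> / (1 + y * s\<^sup>2)
      < ((1 + x * s\<^sup>2) / (1 + x)) powr \<beta> / (1 + x * s\<^sup>2)"
    using pos by (intro frac_less) auto
  then show "(1 + y) powr (-\<beta>) * (1 + y * s\<^sup>2) powr (\<beta> - 1)
      < (1 + x) powr (-\<beta>) * (1 + x * s\<^sup>2) powr (\<beta> - 1)"
    using eq pos by simp
qed (use assms in \<open>auto intro: continuous_time_integrand\<close>)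

lemma continuous_on_time_ratio: "continuous_on {-1<..} (time_ratio \<beta>)"
proof -
  have "continuous_on ({-1<..} \<times> cbox 0 1)
      (\<lambda>(x, s). (1 + x) powr (-\<beta>) * (1 + x * s\<^sup>2) powr (\<beta> - 1))"
    unfolding case_prod_beta
  proof (intro continuous_intros ballI)
    fix p :: "real \<times> real" assume "p \<in> {-1<..} \<times> cbox 0 1"
    then show "1 + fst p \<noteq> 0" "1 + fst p * (snd p)\<^sup>2 \<noteq> 0"
      using one_plus_scaled_square_pos[of "fst p" "snd p"] by auto
  qed
  from integral_continuous_on_param[OF this] show ?thesis
    unfolding time_ratio_def by simp
qed

lemma time_ratio_pos:
  assumes "x > -1"
  shows "time_ratio \<beta> x > 0"
proof -
  have "integral {0..1} (\<lambda>s::real. 0::real) < time_ratio \<beta> x"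
    unfolding time_ratio_def
  proof (rule integral_less_real)
    fix s :: real assume "s \<in> {0<..<1}"
    then show "0 < (1 + x) powr (-\<beta>) * (1 + x * s\<^sup>2) powr (\<beta> - 1)"
      using one_plus_scaled_square_pos[of x s] assms by simp
  qed (use assms in \<open>auto intro: continuous_time_integrand\<close>)
  then show ?thesis by simp
qed

text \<open>
  For \<open>x < 0\<close> and \<open>\<beta> \<le> 1\<close> the factor \<open>(1 + x s\<^sup>2) powr (\<beta> - 1)\<close> is at least \<open>1\<close>, so the integral is
  at least \<open>(1 + x) powr (- \<beta>)\<close>, which blows up at \<open>x = -1\<close>.
\<close>
lemma time_ratio_unbounded:
  assumes "0 < \<beta>" "\<beta> \<le> 1"
  obtains x where "-1 < x" "x < 0" "time_ratio \<beta> x > M"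
proof -
  define N where "N = max M 1 + 1"
  have "N > 1" "N > M" by (auto simp: N_def)
  define x where "x = N powr (-(1/\<beta>)) - 1"
  have "N powr (-(1/\<beta>)) < 1" using \<open>N > 1\<close> assms by (simp add: powr_less_one)
  then have x: "-1 < x" "x < 0" using \<open>N > 1\<close> by (auto simp: x_def)
  have val: "(1 + x) powr (-\<beta>) = N"
    using \<open>N > 1\<close> assms by (simp add: x_def powr_powr)
  have "integral {0..1} (\<lambda>s::real. N) \<le> time_ratio \<beta> x"
    unfolding time_ratio_def val
  proof (rule integral_le)
    show "(\<lambda>s. N * (1 + x * s\<^sup>2) powr (\<beta> - 1)) integrable_on {0..1}"
      using integrable_continuous_real[OF continuous_time_integrand[OF x(1), of \<beta>]] val by simp
    fix s :: real assume "s \<in> {0..1}"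
    have "0 < 1 + x * s\<^sup>2" "1 + x * s\<^sup>2 \<le> 1"
      using one_plus_scaled_square_pos[of x s] x \<open>s \<in> {0..1}\<close> by (auto simp: mult_nonpos_nonneg)
    then have "1 \<le> (1 + x * s\<^sup>2) powr (\<beta> - 1)"
      using powr_mono2'[of "\<beta> - 1" "1 + x * s\<^sup>2" 1] assms by simp
    then show "N \<le> N * (1 + x * s\<^sup>2) powr (\<beta> - 1)" using \<open>N > 1\<close> by simp
  qed auto
  then show ?thesis using that[of x] x \<open>N > M\<close> by simp
qed

section \<open>Arcs starting with zero slope: the time map and uniqueness\<close>
text \<open>
  The number \<open>\<beta>\<close> for which raising the energy identity (powers \<open>2 c\<close> of \<open>y\<close>) to the power \<open>\<beta>\<close> gives
  powers \<open>c - 1\<close> of \<open>y\<close>.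
\<close>
definition phase_exponent :: "real \<Rightarrow> real" where
  "phase_exponent c = (c - 1) / (2 * c)"

text \<open>
  The integral of \<open>(1 + k \<sigma>\<^sup>2) powr (\<beta> - 1)\<close> over \<open>0 \<le> \<sigma> \<le> r\<close>, after the substitution \<open>\<sigma> = r s\<close>: this
  form has the integrand of \<open>time_ratio\<close> up to a constant factor and makes sense for negative \<open>r\<close> too.
\<close>
definition phase_time :: "real \<Rightarrow> real \<Rightarrow> real \<Rightarrow> real" where
  "phase_time \<beta> k r = r * integral {0..1} (\<lambda>s. (1 + k * r\<^sup>2 * s\<^sup>2) powr (\<beta> - 1))"

lemma phase_domain_convex:
  fixes k u v r :: real
  assumes "1 + k * u\<^sup>2 > 0" "1 + k * v\<^sup>2 > 0" "u \<le> r" "r \<le> v"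
  shows "1 + k * r\<^sup>2 > 0"
proof (cases "k \<ge> 0")
  case False
  have "r\<^sup>2 \<le> u\<^sup>2 \<or> r\<^sup>2 \<le> v\<^sup>2"
  proof (cases "r \<ge> 0")
    case True
    then show ?thesis using assms by (auto intro: power_mono)
  next
    case False
    then show ?thesis using assms power_mono[of "- r" "- u" 2] by auto
  qed
  then have "k * u\<^sup>2 \<le> k * r\<^sup>2 \<or> k * v\<^sup>2 \<le> k * r\<^sup>2"
    using False by (auto intro: mult_left_mono_neg)
  then show ?thesis using assms by linarith
qed (simp add: add_pos_nonneg)

text \<open>
  The set where \<open>1 + k r\<^sup>2 > 0\<close> is the open interval \<open>(-w, w)\<close>, with \<open>w = \<infinity>\<close> if \<open>k \<ge> 0\<close> and
  \<open>w = (-k)\<^sup>-\<^sup>1\<^sup>/\<^sup>2\<close> otherwise, and a continuous function on an open interval has an antiderivative.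
\<close>
lemma phase_antiderivative_exists:
  "\<exists>G. \<forall>r::real. 1 + k * r\<^sup>2 > 0 \<longrightarrow> (G has_real_derivative (1 + k * r\<^sup>2) powr \<alpha>) (at r)"
proof -
  define w :: ereal where "w = (if k \<ge> 0 then \<infinity> else ereal (sqrt (1 / (- k))))"
  have w: "1 + k * r\<^sup>2 > 0 \<longleftrightarrow> - w < ereal r \<and> ereal r < w" for r
  proof (cases "k \<ge> 0")
    case True
    then show ?thesis by (simp add: w_def add_pos_nonneg)
  next
    case False
    have "1 + k * r\<^sup>2 > 0 \<longleftrightarrow> r\<^sup>2 < 1 / (- k)"
      using False by (simp add: field_simps; linarith)
    also have "\<dots> \<longleftrightarrow> \<bar>r\<bar> < sqrt (1 / (- k))"
      using False by (metis real_sqrt_abs real_sqrt_less_iff)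
    also have "\<dots> \<longleftrightarrow> - w < ereal r \<and> ereal r < w"
      using False by (auto simp: w_def abs_less_iff)
    finally show ?thesis .
  qed
  have "- w < w" using w[of 0] by (simp add: w_def)
  then have "\<exists>G. \<forall>r::real. - w < r \<longrightarrow> r < w \<longrightarrow>
      (G has_vector_derivative (1 + k * r\<^sup>2) powr \<alpha>) (at r)"
  proof (rule einterval_antiderivative)
    fix r :: real assume "- w < r" "r < w"
    then have "1 + k * r\<^sup>2 \<noteq> 0" using w[of r] by simp
    then show "isCont (\<lambda>r. (1 + k * r\<^sup>2) powr \<alpha>) r" by (intro continuous_intros) auto
  qed
  then show ?thesis unfolding has_real_derivative_iff_has_vector_derivative w by blast
qed

text \<open>
  With an antiderivative \<open>G\<close> of \<open>(1 + k r\<^sup>2) powr (\<beta> - 1)\<close>, the integrand of \<open>phase_time\<close> times \<open>r\<close> is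
  the derivative of \<open>s \<mapsto> G (r s)\<close>, so \<open>phase_time \<beta> k r = G r - G 0\<close>.
\<close>
lemma phase_time_has_derivative:
  assumes "1 + k * r\<^sup>2 > 0"
  shows "(phase_time \<beta> k has_real_derivative (1 + k * r\<^sup>2) powr (\<beta> - 1)) (at r)"
proof -
  obtain G where G: "\<And>r. 1 + k * r\<^sup>2 > 0 \<Longrightarrow> (G has_real_derivative (1 + k * r\<^sup>2) powr (\<beta> - 1)) (at r)"
    using phase_antiderivative_exists by blast
  have val: "phase_time \<beta> k u = G u - G 0" if u: "1 + k * u\<^sup>2 > 0" for u
  proof -
    have "((\<lambda>s. u * (1 + k * u\<^sup>2 * s\<^sup>2) powr (\<beta> - 1)) has_integral G (u * 1) - G (u * 0)) {0..1}"
    proof (rule fundamental_theorem_of_calculus)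
      fix s :: real assume s: "s \<in> {0..1}"
      have "1 + k * (u * s)\<^sup>2 > 0"
        using one_plus_scaled_square_pos[of "k * u\<^sup>2" s] u s by (simp add: power_mult_distrib mult.assoc)
      from G[OF this] have "((\<lambda>s. G (u * s)) has_real_derivative (1 + k * (u * s)\<^sup>2) powr (\<beta> - 1) * u) (at s within {0..1})"
        by (intro DERIV_chain2[where f = G]) (auto intro!: derivative_eq_intros)
      then show "((\<lambda>s. G (u * s)) has_vector_derivative u * (1 + k * u\<^sup>2 * s\<^sup>2) powr (\<beta> - 1)) (at s within {0..1})"
        by (simp add: has_real_derivative_iff_has_vector_derivative power_mult_distrib mult_ac)
    qed simp
    then have "integral {0..1} (\<lambda>s. u * (1 + k * u\<^sup>2 * s\<^sup>2) powr (\<beta> - 1)) = G u - G 0"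
      by (simp only: integral_unique mult_1_right mult_zero_right)
    then show ?thesis by (simp add: phase_time_def)
  qed
  have "((\<lambda>u. G u - G 0) has_real_derivative (1 + k * r\<^sup>2) powr (\<beta> - 1)) (at r)"
    using G[OF assms] by (auto intro!: derivative_eq_intros)
  moreover have "open {u. 0 < 1 + k * u\<^sup>2}" by (intro open_Collect_less continuous_intros)
  ultimately show ?thesis
    by (rule has_field_derivative_transform_within_open) (use assms val in auto)
qed

lemma phase_time_0 [simp]: "phase_time \<beta> k 0 = 0"
  by (simp add: phase_time_def)

lemma phase_time_strict_mono:
  assumes "1 + k * u\<^sup>2 > 0" "1 + k * v\<^sup>2 > 0" "u < v"
  shows "phase_time \<beta> k u < phase_time \<beta> k v"
proof (rule DERIV_pos_imp_increasing[OF \<open>u < v\<close>])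
  fix r assume "u \<le> r" "r \<le> v"
  then have "1 + k * r\<^sup>2 > 0" using assms phase_domain_convex by blast
  then show "\<exists>D. (phase_time \<beta> k has_real_derivative D) (at r) \<and> 0 < D"
    using phase_time_has_derivative by force
qed

lemma phase_time_inj:
  assumes "phase_time \<beta> k u = phase_time \<beta> k v" "1 + k * u\<^sup>2 > 0" "1 + k * v\<^sup>2 > 0"
  shows "u = v"
  using phase_time_strict_mono[of k u v \<beta>] phase_time_strict_mono[of k v u \<beta>] assms
  by (cases u v rule: linorder_cases) auto

lemma phase_time_eq_time_ratio:
  assumes "1 + k * r\<^sup>2 > 0"
  shows "phase_time \<beta> k r = r * (1 + k * r\<^sup>2) powr \<beta> * time_ratio \<beta> (k * r\<^sup>2)"
proof -
  have "(1 + k * r\<^sup>2) powr \<beta> * (1 + k * r\<^sup>2) powr (- \<beta>) = 1"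
    using assms by (simp add: powr_minus)
  then show ?thesis by (simp add: phase_time_def time_ratio_def)
qed

text \<open>
  Conservation of energy on an arc that starts with zero slope, divided by \<open>b / c\<close>, expressed in the
  slope variable \<open>\<rho> = - y' / (b y\<^sup>c)\<close>. Since the right-hand side is positive, \<open>\<rho>\<close> never leaves the
  interval on which \<open>phase_time\<close> is differentiable.
\<close>
lemma power_arc_slope_invariant:
  assumes arc: "power_arc c b 0 L y z" and "z 0 = 0" "c \<noteq> 0" "b \<noteq> 0" "t \<in> {0..L}"
  defines "\<rho> \<equiv> (\<lambda>t. - z t / (b * y t powr c))"
  shows "y t powr (2 * c) * (1 + c * b * (\<rho> t)\<^sup>2) = y 0 powr (2 * c)"
    and "1 + c * b * (\<rho> t)\<^sup>2 > 0"
proof -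
  have y: "y t > 0" "y 0 > 0" using power_arcD(1)[OF arc] assms by auto
  have "(z t)\<^sup>2 + b / c * y t powr (2 * c) = b / c * y 0 powr (2 * c)"
    using power_arc_energy[OF power_arc_subset[OF arc, of 0 t]] assms by simp
  then have "y t powr (2 * c) + c / b * (z t)\<^sup>2 = y 0 powr (2 * c)"
    using assms by (simp add: field_simps)
  moreover have "(\<rho> t)\<^sup>2 * y t powr (2 * c) = (z t)\<^sup>2 / b\<^sup>2"
  proof -
    have "y t powr (2 * c) = (y t powr c)\<^sup>2"
      by (simp add: powr_add[symmetric] power2_eq_square)
    then show ?thesis using y by (simp add: \<rho>_def power_divide power_mult_distrib)
  qed
  ultimately show *: "y t powr (2 * c) * (1 + c * b * (\<rho> t)\<^sup>2) = y 0 powr (2 * c)"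
    using \<open>b \<noteq> 0\<close> by (simp add: algebra_simps power2_eq_square)
  have "y 0 powr (2 * c) > 0" "y t powr (2 * c) > 0" using y by auto
  then show "1 + c * b * (\<rho> t)\<^sup>2 > 0"
    using * by (metis zero_less_mult_pos)
qed

lemma powr_phase_exponent:
  assumes "c \<noteq> 0" "y > 0"
  shows "(y powr (2 * c)) powr phase_exponent c = y powr (c - 1)"
  using assms by (simp add: powr_powr phase_exponent_def)

text \<open>
  The slope variable satisfies \<open>\<rho>' = y\<^sup>c\<^sup>-\<^sup>1 e\<close> with \<open>e = 1 + c b \<rho>\<^sup>2\<close>. Hence \<open>phase_time\<close>, evaluated along
  \<open>\<rho>\<close>, has derivative \<open>e\<^sup>\<beta> y\<^sup>c\<^sup>-\<^sup>1 = (y\<^sup>2\<^sup>c e)\<^sup>\<beta>\<close>, which by conservation of energy is a constant: up to a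
  factor, \<open>phase_time\<close> of the slope variable is the time.
\<close>
lemma power_arc_phase_time:
  assumes arc: "power_arc c b 0 L y z" and "z 0 = 0" "c \<noteq> 0" "b \<noteq> 0" "t \<in> {0..L}"
  shows "phase_time (phase_exponent c) (c * b) (- z t / (b * y t powr c)) = y 0 powr (c - 1) * t"
proof -
  define \<beta> where "\<beta> = phase_exponent c"
  define \<rho> where "\<rho> = (\<lambda>t. - z t / (b * y t powr c))"
  define h where "h = (\<lambda>t. phase_time \<beta> (c * b) (\<rho> t) - y 0 powr (c - 1) * t)"
  have "(h has_real_derivative 0) (at s within {0..L})" if s: "s \<in> {0..L}" for s
  proof -
    note d = power_arcD[OF arc s]
    define e where "e = 1 + c * b * (\<rho> s)\<^sup>2"
    have inv: "y s powr (2 * c) * e = y 0 powr (2 * c)" and e: "e > 0"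
      using power_arc_slope_invariant[OF arc _ _ _ s] assms by (auto simp: e_def \<rho>_def)
    have z: "z s = - b * \<rho> s * y s powr c" using d(1) assms by (simp add: \<rho>_def)
    have "((\<lambda>t. - (1 / b) * (z t * y t powr (- c))) has_real_derivative
        - (1 / b) * (- b * y s powr (2 * c - 1) * y s powr (- c) + (- c * y s powr (- c - 1) * z s) * z s))
        (at s within {0..L})"
      using d \<open>b \<noteq> 0\<close> by (auto intro!: derivative_eq_intros)
    also have "(\<lambda>t. - (1 / b) * (z t * y t powr (- c))) = \<rho>"
      by (simp add: \<rho>_def powr_minus field_simps fun_eq_iff)
    also have "- (1 / b) * (- b * y s powr (2 * c - 1) * y s powr (- c) + (- c * y s powr (- c - 1) * z s) * z s)
        = y s powr (c - 1) * e"
    proof -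
      have "y s powr (2 * c - 1) * y s powr (- c) = y s powr (c - 1)"
        by (simp add: powr_add[symmetric])
      moreover have "y s powr (- c - 1) * (y s powr c * y s powr c) = y s powr (c - 1)"
        by (simp add: powr_add[symmetric])
      ultimately show ?thesis
        unfolding z e_def using \<open>b \<noteq> 0\<close> by (simp add: field_simps power2_eq_square)
    qed
    finally have \<rho>': "(\<rho> has_real_derivative y s powr (c - 1) * e) (at s within {0..L})" .
    have "((\<lambda>t. phase_time \<beta> (c * b) (\<rho> t)) has_real_derivative
        e powr (\<beta> - 1) * (y s powr (c - 1) * e)) (at s within {0..L})"
      using phase_time_has_derivative[of "c * b" "\<rho> s" \<beta>] e
      by (intro DERIV_chain2[OF _ \<rho>']) (simp add: e_def)
    moreover have "e powr (\<beta> - 1) * (y s powr (c - 1) * e) = y 0 powr (c - 1)"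
    proof -
      have "e powr (\<beta> - 1) * e = e powr \<beta>" using e by (simp add: powr_diff)
      then have "e powr (\<beta> - 1) * (y s powr (c - 1) * e) = y s powr (c - 1) * e powr \<beta>"
        by (simp add: mult_ac)
      also have "\<dots> = (y s powr (2 * c) * e) powr \<beta>"
        using powr_phase_exponent[OF \<open>c \<noteq> 0\<close> d(1)] e by (simp add: powr_mult \<beta>_def)
      also have "\<dots> = y 0 powr (c - 1)"
        unfolding inv using powr_phase_exponent[OF \<open>c \<noteq> 0\<close>, of "y 0"] power_arcD(1)[OF arc, of 0] s
        by (simp add: \<beta>_def)
      finally show ?thesis .
    qed
    ultimately show ?thesis
      unfolding h_def by (auto intro!: derivative_eq_intros)
  qed
  then have "h t = h 0"
    using has_field_derivative_zero_constant[of "{0..L}" h] assms by force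
  then show ?thesis using assms by (simp add: h_def \<rho>_def \<beta>_def)
qed

text \<open>
  Conservation of energy eliminates the initial value from \<open>power_arc_phase_time\<close>. What remains links
  the length of the arc with the data at its end only, which is what the gluing at \<open>\<tau>\<close> requires.
\<close>
lemma power_arc_time_map:
  assumes arc: "power_arc c b 0 L y z" and "z 0 = 0" "c \<noteq> 0" "b \<noteq> 0" "L > 0"
  defines "r \<equiv> - z L / (b * y L powr c)"
  shows "r > 0" "1 + c * b * r\<^sup>2 > 0"
    "L * y L powr (c - 1) = r * time_ratio (phase_exponent c) (c * b * r\<^sup>2)"
proof -
  define e where "e = 1 + c * b * r\<^sup>2"
  have L: "L \<in> {0..L}" using \<open>L > 0\<close> by simp
  have y: "y 0 > 0" "y L > 0" using power_arcD(1)[OF arc] \<open>L > 0\<close> by auto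
  show e: "1 + c * b * r\<^sup>2 > 0"
    using power_arc_slope_invariant(2)[OF arc _ _ _ L] assms by simp
  have ph: "phase_time (phase_exponent c) (c * b) r = y 0 powr (c - 1) * L"
    using power_arc_phase_time[OF arc _ _ _ L] assms by simp
  then have "phase_time (phase_exponent c) (c * b) 0 < phase_time (phase_exponent c) (c * b) r"
    using y \<open>L > 0\<close> by simp
  then show "r > 0"
    using phase_time_strict_mono[of "c * b" r 0 "phase_exponent c"] e by (cases r "0::real" rule: linorder_cases) auto
  have "y 0 powr (c - 1) = (y L powr (2 * c) * e) powr phase_exponent c"
    using power_arc_slope_invariant(1)[OF arc _ _ _ L] assms powr_phase_exponent[OF \<open>c \<noteq> 0\<close> y(1)]
    by (simp add: e_def)
  also have "\<dots> = y L powr (c - 1) * e powr phase_exponent c"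
    using e powr_phase_exponent[OF \<open>c \<noteq> 0\<close> y(2)] by (simp add: powr_mult e_def)
  finally have "e powr phase_exponent c * (L * y L powr (c - 1))
      = e powr phase_exponent c * (r * time_ratio (phase_exponent c) (c * b * r\<^sup>2))"
    using ph phase_time_eq_time_ratio[OF e, of "phase_exponent c"] by (simp only: e_def mult_ac)
  then show "L * y L powr (c - 1) = r * time_ratio (phase_exponent c) (c * b * r\<^sup>2)"
    using e by (simp add: e_def)
qed

lemma powr_inject_base:
  fixes x y :: real
  assumes "x powr a = y powr a" "x > 0" "y > 0" "a \<noteq> 0"
  shows "x = y"
  by (metis assms powr_inj powr_powr powr_one right_inverse order_less_imp_le)

text \<open>
  The initial value determines \<open>phase_time\<close> of the slope variable at time \<open>t\<close>, hence the slope variable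
  by injectivity, hence \<open>y t\<close> by conservation of energy.
\<close>
lemma power_arc_unique:
  assumes 1: "power_arc c b 0 L y1 z1" "z1 0 = 0" and 2: "power_arc c b 0 L y2 z2" "z2 0 = 0"
    and "y1 0 = y2 0" "c \<noteq> 0" "b \<noteq> 0" "t \<in> {0..L}"
  shows "y1 t = y2 t"
proof -
  let ?r1 = "- z1 t / (b * y1 t powr c)" and ?r2 = "- z2 t / (b * y2 t powr c)"
  note i1 = power_arc_slope_invariant[OF 1 \<open>c \<noteq> 0\<close> \<open>b \<noteq> 0\<close> \<open>t \<in> {0..L}\<close>]
  note i2 = power_arc_slope_invariant[OF 2 \<open>c \<noteq> 0\<close> \<open>b \<noteq> 0\<close> \<open>t \<in> {0..L}\<close>]
  have "phase_time (phase_exponent c) (c * b) ?r1 = phase_time (phase_exponent c) (c * b) ?r2"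
    using power_arc_phase_time[OF 1 \<open>c \<noteq> 0\<close> \<open>b \<noteq> 0\<close> \<open>t \<in> {0..L}\<close>]
      power_arc_phase_time[OF 2 \<open>c \<noteq> 0\<close> \<open>b \<noteq> 0\<close> \<open>t \<in> {0..L}\<close>] \<open>y1 0 = y2 0\<close> by simp
  then have "?r1 = ?r2" using phase_time_inj i1(2) i2(2) by blast
  then have "y1 t powr (2 * c) = y2 t powr (2 * c)"
    using i1 i2 \<open>y1 0 = y2 0\<close> by (metis mult_right_cancel less_irrefl)
  then show ?thesis
    using powr_inject_base[of "y1 t" "2 * c" "y2 t"] power_arcD(1)[OF 1(1)] power_arcD(1)[OF 2(1)] assms by simp
qed

section \<open>Construction of arcs\<close>
text \<open>
  The arc is written down explicitly. The slope variable \<open>\<rho>\<close> at time \<open>t\<close> is found by inverting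
  \<open>phase_time\<close> at \<open>C t\<close>, and \<open>y\<close> is then read off from conservation of energy,
  \<open>y\<^sup>2\<^sup>c (1 + c b \<rho>\<^sup>2) = y0\<^sup>2\<^sup>c\<close>; the hypothesis on \<open>L\<close> says exactly that \<open>\<rho>\<close> arrives at \<open>r\<close> at time
  \<open>L\<close>. The inverse is taken on a whole open interval around \<open>[0,r]\<close>, so all derivatives are
  two-sided.
\<close>
lemma power_arc_exists:
  assumes "c \<noteq> 0" "b \<noteq> 0" "L \<ge> 0" "Y > 0" "r \<ge> 0" and dom: "1 + c * b * r\<^sup>2 > 0"
    and time: "L * Y powr (c - 1) = r * time_ratio (phase_exponent c) (c * b * r\<^sup>2)"
  obtains y z where "power_arc c b 0 L y z" "z 0 = 0" "y L = Y" "z L = - b * r * Y powr c"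
proof -
  define \<beta> where "\<beta> = phase_exponent c"
  define D where "D = {s. 1 + c * b * s\<^sup>2 > 0}"
  define F where "F = phase_time \<beta> (c * b)"
  define \<psi> where "\<psi> = inv_into D F"
  \<comment> \<open>The initial value and the speed of the phase that energy conservation and
     the phase equation assign to the end value \<open>Y\<close> and the final slope variable \<open>r\<close>.\<close>
  define y0 where "y0 = Y * (1 + c * b * r\<^sup>2) powr (1 / (2 * c))"
  define C where "C = y0 powr (c - 1)"
  define \<rho> where "\<rho> = (\<lambda>t. \<psi> (C * t))"
  define e where "e = (\<lambda>t. 1 + c * b * (\<rho> t)\<^sup>2)"
  define y where "y = (\<lambda>t. y0 * e t powr (- 1 / (2 * c)))"
  define z where "z = (\<lambda>t. - b * \<rho> t * y t powr c)"
  have "y0 > 0" using dom \<open>Y > 0\<close> by (simp add: y0_def)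
  then have "C > 0" by (simp add: C_def)
  have "open D" unfolding D_def by (intro open_Collect_less continuous_intros)
  have F': "(F has_real_derivative (1 + c * b * s\<^sup>2) powr (\<beta> - 1)) (at s)" if "s \<in> D" for s
    using that unfolding F_def D_def by (intro phase_time_has_derivative) auto
  have contF: "continuous_on D F"
    using F' by (meson DERIV_continuous_on has_field_derivative_at_within)
  have \<psi>F: "\<psi> (F s) = s" if "s \<in> D" for s
    unfolding \<psi>_def by (rule inv_into_f_f[OF _ that]) (auto simp: inj_on_def F_def D_def intro: phase_time_inj)
  have CL: "F r = C * L"
  proof -
    have "C = Y powr (c - 1) * (1 + c * b * r\<^sup>2) powr \<beta>"
      using \<open>Y > 0\<close> dom \<open>c \<noteq> 0\<close>
      by (simp add: C_def y0_def powr_mult powr_powr \<beta>_def phase_exponent_def)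
    then have "C * L = (1 + c * b * r\<^sup>2) powr \<beta> * (L * Y powr (c - 1))" by simp
    then show ?thesis
      unfolding F_def time phase_time_eq_time_ratio[OF dom] \<beta>_def by simp
  qed
  have \<rho>0: "\<rho> 0 = 0" using \<psi>F[of 0] by (simp add: \<rho>_def F_def D_def)
  have "r \<in> D" "0 \<in> D" using dom by (auto simp: D_def)
  have \<rho>L: "\<rho> L = r" using \<psi>F[OF \<open>r \<in> D\<close>] by (simp add: \<rho>_def CL)
  have ex: "\<rho> t \<in> D \<and> F (\<rho> t) = C * t" if t: "t \<in> {0..L}" for t
  proof -
    have sub: "{0..r} \<subseteq> D"
      using phase_domain_convex[of "c * b" 0 r] dom by (auto simp: D_def)
    have "F 0 \<le> C * t" using t \<open>C > 0\<close> by (simp add: F_def)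
    moreover have "C * t \<le> F r" using t \<open>C > 0\<close> by (simp add: CL)
    ultimately obtain s where s: "s \<in> {0..r}" "F s = C * t"
      using IVT'[of F 0 "C * t" r] \<open>r \<ge> 0\<close> continuous_on_subset[OF contF sub] by auto
    then show ?thesis using \<psi>F[of s] sub by (auto simp: \<rho>_def)
  qed
  have \<rho>': "(\<rho> has_real_derivative C * e t powr (1 - \<beta>)) (at t)" if t: "t \<in> {0..L}" for t
  proof -
    have et: "e t > 0" using ex[OF t] by (simp add: e_def D_def)
    have dF: "(F has_derivative (*) (e t powr (\<beta> - 1))) (at (\<rho> t))"
      using F'[of "\<rho> t"] ex[OF t] by (simp add: has_field_derivative_def e_def)
    have "(\<psi> has_derivative (*) (e t powr (1 - \<beta>))) (at (F (\<rho> t)))"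
      by (rule has_derivative_inverse_strong[OF \<open>open D\<close> _ contF \<psi>F dF])
        (use ex[OF t] et in \<open>auto simp: fun_eq_iff powr_add[symmetric] mult.assoc[symmetric]\<close>)
    then have "(\<psi> has_real_derivative e t powr (1 - \<beta>)) (at (C * t))"
      using ex[OF t] by (simp add: has_field_derivative_def)
    then have "((\<lambda>t. \<psi> (C * t)) has_real_derivative e t powr (1 - \<beta>) * C) (at t)"
      by (rule DERIV_chain2) (auto intro!: derivative_eq_intros)
    then show ?thesis by (simp add: \<rho>_def mult.commute)
  qed
  have "power_arc c b 0 L y z"
    unfolding power_arc_def
  proof
    fix t assume t: "t \<in> {0..L}"
    have e: "e t > 0" using ex[OF t] by (simp add: e_def D_def)
    have y: "y t > 0" using \<open>y0 > 0\<close> e by (simp add: y_def)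
    have yp: "y t powr a = y0 powr a * e t powr (- a / (2 * c))" for a
      using \<open>y0 > 0\<close> e by (simp add: y_def powr_mult powr_powr)
    have e': "(e has_real_derivative c * b * (2 * \<rho> t * (C * e t powr (1 - \<beta>)))) (at t)"
      unfolding e_def using \<rho>'[OF t] by (auto intro!: derivative_eq_intros simp: e_def)
    have "(y has_real_derivative y0 * ((- 1 / (2 * c)) * e t powr (- 1 / (2 * c) - 1)
        * (c * b * (2 * \<rho> t * (C * e t powr (1 - \<beta>)))))) (at t)"
      unfolding y_def using e' e \<open>c \<noteq> 0\<close> by (auto intro!: derivative_eq_intros)
    also have "y0 * ((- 1 / (2 * c)) * e t powr (- 1 / (2 * c) - 1)
        * (c * b * (2 * \<rho> t * (C * e t powr (1 - \<beta>)))))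
      = - b * \<rho> t * ((y0 * C) * (e t powr (- 1 / (2 * c) - 1) * e t powr (1 - \<beta>)))"
      using \<open>c \<noteq> 0\<close> by (simp add: field_simps)
    also have "(y0 * C) * (e t powr (- 1 / (2 * c) - 1) * e t powr (1 - \<beta>)) = y t powr c"
    proof -
      have "y0 * C = y0 powr c"
        using \<open>y0 > 0\<close> by (simp add: C_def powr_diff)
      moreover have "- 1 / (2 * c) - 1 + (1 - \<beta>) = - c / (2 * c)"
        using \<open>c \<noteq> 0\<close> by (simp add: \<beta>_def phase_exponent_def field_simps)
      ultimately show ?thesis by (simp only: yp powr_add[symmetric])
    qed
    finally have y': "(y has_real_derivative z t) (at t)" by (simp add: z_def)
    have "(z has_real_derivative - b * ((C * e t powr (1 - \<beta>)) * y t powr c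
        + \<rho> t * (c * y t powr (c - 1) * z t))) (at t)"
      unfolding z_def using y' y \<rho>'[OF t]
      by (auto intro!: derivative_eq_intros simp: z_def algebra_simps)
    also have "(C * e t powr (1 - \<beta>)) * y t powr c + \<rho> t * (c * y t powr (c - 1) * z t)
        = y t powr (2 * c - 1)"
    proof -
      have "(C * e t powr (1 - \<beta>)) * y t powr c
          = (y0 powr (c - 1) * y0 powr c) * (e t powr (1 - \<beta>) * e t powr (- c / (2 * c)))"
        by (simp add: yp C_def)
      also have "\<dots> = y0 powr (2 * c - 1) * e t powr (1 / (2 * c))"
      proof -
        have "1 - \<beta> + - c / (2 * c) = 1 / (2 * c)"
          using \<open>c \<noteq> 0\<close> by (simp add: \<beta>_def phase_exponent_def field_simps)
        then show ?thesis by (simp only: powr_add[symmetric]) (simp add: algebra_simps)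
      qed
      also have "\<dots> = y t powr (2 * c - 1) * e t"
      proof -
        have "1 / (2 * c) = - (2 * c - 1) / (2 * c) + 1" using \<open>c \<noteq> 0\<close> by (simp add: field_simps)
        then have "e t powr (1 / (2 * c)) = e t powr (- (2 * c - 1) / (2 * c)) * e t"
          using e by (metis powr_add powr_one less_imp_le)
        then show ?thesis by (simp add: yp)
      qed
      finally have A: "(C * e t powr (1 - \<beta>)) * y t powr c = y t powr (2 * c - 1) * e t" .
      have "y t powr (c - 1) * y t powr c = y t powr (2 * c - 1)"
        by (simp add: powr_add[symmetric])
      then have "\<rho> t * (c * y t powr (c - 1) * z t) = - (c * b * (\<rho> t)\<^sup>2) * y t powr (2 * c - 1)"
        by (simp add: z_def power2_eq_square algebra_simps)
      then show ?thesis unfolding A by (simp add: e_def algebra_simps)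
    qed
    finally have z': "(z has_real_derivative - b * y t powr (2 * c - 1)) (at t)" .
    show "y t > 0 \<and> (y has_real_derivative z t) (at t within {0..L}) \<and>
        (z has_real_derivative - b * y t powr (2 * c - 1)) (at t within {0..L})"
      using y y' z' has_field_derivative_at_within by blast
  qed
  moreover have "z 0 = 0" by (simp add: z_def \<rho>0)
  moreover have "y L = Y"
    using dom by (simp add: y_def y0_def e_def \<rho>L powr_add[symmetric])
  moreover from this have "z L = - b * r * Y powr c" by (simp add: z_def \<rho>L)
  ultimately show ?thesis using that by blast
qed

section \<open>Gluing a concave and a convex arc\<close>
text \<open>
  Two arcs with coefficients \<open>\<alpha>1\<close> and \<open>- \<alpha>2\<close> and lengths \<open>l1\<close> and \<open>l2\<close> fit together only if this
  function, for \<open>m1 = \<alpha>1 l1\<close> and \<open>m2 = \<alpha>2 l2\<close>, vanishes at \<open>\<xi> = c R\<^sup>2\<close>, where \<open>R\<close> is the common value of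
  \<open>\<bar>y'\<bar> / y\<^sup>c\<close> at the meeting point. It comes from dividing the two time maps by each other.
\<close>
definition balance :: "real \<Rightarrow> real \<Rightarrow> real \<Rightarrow> real \<Rightarrow> real \<Rightarrow> real \<Rightarrow> real" where
  "balance \<beta> \<alpha>1 \<alpha>2 m1 m2 \<xi> = m1 * time_ratio \<beta> (- \<xi> / \<alpha>2) - m2 * time_ratio \<beta> (\<xi> / \<alpha>1)"

lemma balance_strict_mono:
  assumes "\<beta> > 0" "\<alpha>1 > 0" "\<alpha>2 > 0" "m1 > 0" "m2 > 0" "- \<alpha>1 < \<xi>" "\<xi> < \<eta>" "\<eta> < \<alpha>2"
  shows "balance \<beta> \<alpha>1 \<alpha>2 m1 m2 \<xi> < balance \<beta> \<alpha>1 \<alpha>2 m1 m2 \<eta>"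
proof -
  have "time_ratio \<beta> (- \<xi> / \<alpha>2) < time_ratio \<beta> (- \<eta> / \<alpha>2)"
    using assms by (intro time_ratio_strict_antimono) (auto simp: field_simps)
  moreover have "time_ratio \<beta> (\<eta> / \<alpha>1) < time_ratio \<beta> (\<xi> / \<alpha>1)"
    using assms by (intro time_ratio_strict_antimono) (auto simp: field_simps)
  ultimately show ?thesis
    using assms unfolding balance_def by (intro diff_strict_mono mult_strict_left_mono)
qed

text \<open>
  At \<open>0\<close> the function has the value \<open>m1 - m2 < 0\<close>; close to \<open>\<alpha>2\<close> its first term tends to infinity,
  while the second one stays below \<open>m2\<close>. The intermediate value theorem gives a root in between.
\<close>
lemma balance_root_exists_pos:
  assumes "0 < \<beta>" "\<beta> \<le> 1" "\<alpha>1 > 0" "\<alpha>2 > 0" "m1 > 0" "m1 < m2"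
  obtains \<xi> where "0 < \<xi>" "\<xi> < \<alpha>2" "balance \<beta> \<alpha>1 \<alpha>2 m1 m2 \<xi> = 0"
proof -
  obtain x where x: "-1 < x" "x < 0" "time_ratio \<beta> x > m2 / m1"
    using time_ratio_unbounded assms by blast
  \<comment> \<open>At this point the argument \<open>- \<eta> / \<alpha>2\<close> of the first term is \<open>x\<close>.\<close>
  define \<eta> where "\<eta> = - \<alpha>2 * x"
  have \<eta>: "0 < \<eta>" "\<eta> < \<alpha>2"
    using x assms mult_strict_left_mono[of "-x" 1 \<alpha>2] by (auto simp: \<eta>_def mult_pos_neg)
  have "time_ratio \<beta> (\<eta> / \<alpha>1) < 1"
    using time_ratio_strict_antimono[of \<beta> 0 "\<eta> / \<alpha>1"] assms \<eta> by simp
  then have "m2 * time_ratio \<beta> (\<eta> / \<alpha>1) < m2" using assms by simp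
  moreover have "m1 * time_ratio \<beta> (- \<eta> / \<alpha>2) > m2"
    using x assms by (simp add: \<eta>_def field_simps)
  ultimately have "balance \<beta> \<alpha>1 \<alpha>2 m1 m2 \<eta> > 0" by (simp add: balance_def)
  moreover have "balance \<beta> \<alpha>1 \<alpha>2 m1 m2 0 < 0" using assms by (simp add: balance_def)
  moreover have "continuous_on {0..\<eta>} (balance \<beta> \<alpha>1 \<alpha>2 m1 m2)"
  proof -
    have "- \<xi> / \<alpha>2 > -1" "\<xi> / \<alpha>1 > -1" if "\<xi> \<in> {0..\<eta>}" for \<xi>
    proof -
      show "- \<xi> / \<alpha>2 > -1" using that \<eta> by (simp add: field_simps)
      have "\<xi> / \<alpha>1 \<ge> 0" using that assms by simp
      then show "\<xi> / \<alpha>1 > -1" by linarith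
    qed
    then have "continuous_on {0..\<eta>} (\<lambda>\<xi>. time_ratio \<beta> (- \<xi> / \<alpha>2))"
      "continuous_on {0..\<eta>} (\<lambda>\<xi>. time_ratio \<beta> (\<xi> / \<alpha>1))"
      using assms by (auto intro!: continuous_on_compose2[OF continuous_on_time_ratio] continuous_intros)
    then show ?thesis unfolding balance_def by (intro continuous_intros)
  qed
  ultimately obtain \<xi> where \<xi>: "0 \<le> \<xi>" "\<xi> \<le> \<eta>" "balance \<beta> \<alpha>1 \<alpha>2 m1 m2 \<xi> = 0"
    using IVT'[of "balance \<beta> \<alpha>1 \<alpha>2 m1 m2" 0 0 \<eta>] \<eta> by auto
  then have "\<xi> \<noteq> 0" using \<open>balance \<beta> \<alpha>1 \<alpha>2 m1 m2 0 < 0\<close> by auto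
  then show ?thesis using that[of \<xi>] \<xi> \<eta> by simp
qed

lemma balance_swap: "balance \<beta> \<alpha>1 \<alpha>2 m1 m2 \<xi> = - balance \<beta> \<alpha>2 \<alpha>1 m2 m1 (- \<xi>)"
  by (simp add: balance_def)

lemma balance_root_exists:
  assumes "0 < \<beta>" "\<beta> \<le> 1" "\<alpha>1 > 0" "\<alpha>2 > 0" "m1 > 0" "m2 > 0" "c * (m1 - m2) < 0"
  obtains \<xi> where "- \<alpha>1 < \<xi>" "\<xi> < \<alpha>2" "c * \<xi> > 0" "balance \<beta> \<alpha>1 \<alpha>2 m1 m2 \<xi> = 0"
proof (cases "c > 0")
  case True
  then have "m1 < m2" using assms by (simp add: mult_less_0_iff)
  then obtain \<xi> where "0 < \<xi>" "\<xi> < \<alpha>2" "balance \<beta> \<alpha>1 \<alpha>2 m1 m2 \<xi> = 0"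
    using balance_root_exists_pos assms by blast
  then show ?thesis using that[of \<xi>] True assms by simp
next
  case False
  then have "c < 0" "m2 < m1" using assms by (auto simp: mult_less_0_iff)
  then obtain \<xi> where "0 < \<xi>" "\<xi> < \<alpha>1" "balance \<beta> \<alpha>2 \<alpha>1 m2 m1 \<xi> = 0"
    using balance_root_exists_pos assms by blast
  then show ?thesis using that[of "- \<xi>"] \<open>c < 0\<close> assms balance_swap[of \<beta> \<alpha>1 \<alpha>2 m1 m2 "- \<xi>"]
    by (simp add: mult_neg_pos)
qed

text \<open>
  Two arcs with zero initial slope, the second one traversed backwards, meet in a \<open>C\<^sup>1\<close> way: the
  time reversal changes the sign of the slope.
\<close>
definition junction ::
    "real \<Rightarrow> real \<Rightarrow> real \<Rightarrow> real \<Rightarrow> real \<Rightarrow> (real \<Rightarrow> real) \<Rightarrow> (real \<Rightarrow> real) \<Rightarrow> (real \<Rightarrow> real) \<Rightarrow> (real \<Rightarrow> real) \<Rightarrow> bool" where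
  "junction c \<alpha>1 \<alpha>2 l1 l2 y1 z1 y2 z2 \<longleftrightarrow>
     power_arc c \<alpha>1 0 l1 y1 z1 \<and> z1 0 = 0 \<and> power_arc c (- \<alpha>2) 0 l2 y2 z2 \<and> z2 0 = 0 \<and>
     y1 l1 = y2 l2 \<and> z1 l1 = - z2 l2"

text \<open>
  Both time maps hold at the meeting point with the same value of \<open>y\<close> and with slope variables
  \<open>R / \<alpha>1\<close> and \<open>R / \<alpha>2\<close>. Cross-multiplication removes \<open>y\<close> and \<open>R\<close>.
\<close>
lemma junction_balance:
  assumes J: "junction c \<alpha>1 \<alpha>2 l1 l2 y1 z1 y2 z2"
    and pos: "\<alpha>1 > 0" "\<alpha>2 > 0" "l1 > 0" "l2 > 0" and "c \<noteq> 0"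
  defines "R \<equiv> - z1 l1 / y1 l1 powr c"
  shows "R > 0" "- \<alpha>1 < c * R\<^sup>2" "c * R\<^sup>2 < \<alpha>2"
    "balance (phase_exponent c) \<alpha>1 \<alpha>2 (\<alpha>1 * l1) (\<alpha>2 * l2) (c * R\<^sup>2) = 0"
    "l1 * y1 l1 powr (c - 1) = R / \<alpha>1 * time_ratio (phase_exponent c) (c * R\<^sup>2 / \<alpha>1)"
    "y1 0 powr (2 * c) = y1 l1 powr (2 * c) * (1 + c * R\<^sup>2 / \<alpha>1)"
    "y2 0 powr (2 * c) = y1 l1 powr (2 * c) * (1 - c * R\<^sup>2 / \<alpha>2)"
proof -
  have a1: "power_arc c \<alpha>1 0 l1 y1 z1" "z1 0 = 0" and a2: "power_arc c (- \<alpha>2) 0 l2 y2 z2" "z2 0 = 0"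
    and m: "y2 l2 = y1 l1" "z2 l2 = - z1 l1"
    using J by (auto simp: junction_def)
  define r1 where "r1 = - z1 l1 / (\<alpha>1 * y1 l1 powr c)"
  define r2 where "r2 = - z2 l2 / (- \<alpha>2 * y2 l2 powr c)"
  have r: "r1 = R / \<alpha>1" "r2 = R / \<alpha>2" by (auto simp: r1_def r2_def R_def m)
  have x: "c * \<alpha>1 * r1\<^sup>2 = c * R\<^sup>2 / \<alpha>1" "c * (- \<alpha>2) * r2\<^sup>2 = - (c * R\<^sup>2) / \<alpha>2"
    using pos by (auto simp: r power2_eq_square)
  have t1: "r1 > 0" "1 + c * R\<^sup>2 / \<alpha>1 > 0"
     "l1 * y1 l1 powr (c - 1) = r1 * time_ratio (phase_exponent c) (c * R\<^sup>2 / \<alpha>1)"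
    using power_arc_time_map[OF a1, folded r1_def, unfolded x] \<open>c \<noteq> 0\<close> pos by auto
  have t2: "1 + - (c * R\<^sup>2) / \<alpha>2 > 0"
     "l2 * y2 l2 powr (c - 1) = r2 * time_ratio (phase_exponent c) (- (c * R\<^sup>2) / \<alpha>2)"
    using power_arc_time_map[OF a2, folded r2_def, unfolded x] \<open>c \<noteq> 0\<close> pos by auto
  show "R > 0" using t1(1) pos by (simp add: r zero_less_divide_iff)
  show "- \<alpha>1 < c * R\<^sup>2" "c * R\<^sup>2 < \<alpha>2" using t1(2) t2(1) pos by (auto simp: field_simps)
  show t: "l1 * y1 l1 powr (c - 1) = R / \<alpha>1 * time_ratio (phase_exponent c) (c * R\<^sup>2 / \<alpha>1)"
    using t1(3) r by simp
  show "balance (phase_exponent c) \<alpha>1 \<alpha>2 (\<alpha>1 * l1) (\<alpha>2 * l2) (c * R\<^sup>2) = 0"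
  proof -
    \<comment> \<open>The two time maps, with slope variables \<open>R / \<alpha>1\<close> and \<open>R / \<alpha>2\<close>, cleared of denominators.\<close>
    define U where "U = y1 l1 powr (c - 1)"
    have "U > 0" using power_arcD(1)[OF a1(1), of l1] pos by (simp add: U_def)
    define P where "P = time_ratio (phase_exponent c) (c * R\<^sup>2 / \<alpha>1)"
    define Q where "Q = time_ratio (phase_exponent c) (- (c * R\<^sup>2) / \<alpha>2)"
    have "\<alpha>1 * l1 * U = R * P" "\<alpha>2 * l2 * U = R * Q"
      using t t2(2) pos unfolding r m U_def P_def Q_def by (auto simp: field_simps)
    note PQ = this
    have "U * (\<alpha>1 * l1 * Q) = (\<alpha>1 * l1 * U) * Q" by (simp add: mult_ac)
    also have "\<dots> = (\<alpha>2 * l2 * U) * P" unfolding PQ by (simp add: mult_ac)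
    also have "\<dots> = U * (\<alpha>2 * l2 * P)" by (simp add: mult_ac)
    finally have "U * (\<alpha>1 * l1 * Q) = U * (\<alpha>2 * l2 * P)" .
    then have "\<alpha>1 * l1 * Q = \<alpha>2 * l2 * P" using \<open>U > 0\<close> by simp
    then show ?thesis by (simp add: balance_def P_def Q_def)
  qed
  show "y1 0 powr (2 * c) = y1 l1 powr (2 * c) * (1 + c * R\<^sup>2 / \<alpha>1)"
    using power_arc_slope_invariant(1)[OF a1 \<open>c \<noteq> 0\<close>, of l1, folded r1_def, unfolded x] pos by simp
  show "y2 0 powr (2 * c) = y1 l1 powr (2 * c) * (1 - c * R\<^sup>2 / \<alpha>2)"
    using power_arc_slope_invariant(1)[OF a2 \<open>c \<noteq> 0\<close>, of l2, folded r2_def, unfolded x] pos m by simp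
qed

lemma phase_exponent_pos: "c < 0 \<or> c > 1 \<Longrightarrow> phase_exponent c > 0"
  by (auto simp: phase_exponent_def zero_less_divide_iff)

text \<open>
  The root \<open>\<xi> = c R\<^sup>2\<close> of the increasing function \<open>balance\<close> has the sign of \<open>c\<close>, so the value at \<open>0\<close>,
  which is \<open>\<alpha>1 l1 - \<alpha>2 l2\<close>, has the opposite sign.
\<close>
lemma junction_sign:
  assumes J: "junction c \<alpha>1 \<alpha>2 l1 l2 y1 z1 y2 z2"
    and pos: "\<alpha>1 > 0" "\<alpha>2 > 0" "l1 > 0" "l2 > 0" and c: "c < 0 \<or> c > 1"
  shows "c * (\<alpha>1 * l1 - \<alpha>2 * l2) < 0"
proof -
  define \<xi> where "\<xi> = c * (- z1 l1 / y1 l1 powr c)\<^sup>2"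
  let ?B = "balance (phase_exponent c) \<alpha>1 \<alpha>2 (\<alpha>1 * l1) (\<alpha>2 * l2)"
  have "c \<noteq> 0" using c by auto
  note j = junction_balance[OF J pos \<open>c \<noteq> 0\<close>, folded \<xi>_def]
  have B0: "?B 0 = \<alpha>1 * l1 - \<alpha>2 * l2" by (simp add: balance_def)
  note mono = balance_strict_mono[OF phase_exponent_pos[OF c] pos(1,2) mult_pos_pos[OF pos(1,3)] mult_pos_pos[OF pos(2,4)]]
  have sq: "(- z1 l1 / y1 l1 powr c)\<^sup>2 > 0" by (rule zero_less_power[OF j(1)])
  show ?thesis
  proof (cases "c > 0")
    case True
    then have "\<xi> > 0" using sq unfolding \<xi>_def by (rule mult_pos_pos)
    then have "?B 0 < 0" using mono[of 0 \<xi>] j pos by simp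
    then show ?thesis using True B0 by (simp add: mult_pos_neg)
  next
    case False
    then have "\<xi> < 0" using sq \<open>c \<noteq> 0\<close> unfolding \<xi>_def by (intro mult_neg_pos) auto
    then have "?B 0 > 0" using mono[of \<xi> 0] j pos by simp
    then show ?thesis using False \<open>c \<noteq> 0\<close> B0 by (simp add: mult_neg_pos)
  qed
qed

text \<open>
  Strict monotonicity of \<open>balance\<close> determines \<open>R\<close>; the time map then determines the common value at
  the meeting point (as \<open>c \<noteq> 1\<close>), conservation of energy determines both initial values, and these
  determine the arcs.
\<close>
lemma junction_unique:
  assumes J: "junction c \<alpha>1 \<alpha>2 l1 l2 y1 z1 y2 z2" and J': "junction c \<alpha>1 \<alpha>2 l1 l2 y1' z1' y2' z2'"
    and pos: "\<alpha>1 > 0" "\<alpha>2 > 0" "l1 > 0" "l2 > 0" and c: "c < 0 \<or> c > 1"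
  shows "t \<in> {0..l1} \<Longrightarrow> y1 t = y1' t" "t \<in> {0..l2} \<Longrightarrow> y2 t = y2' t"
proof -
  define R where "R = - z1 l1 / y1 l1 powr c"
  define R' where "R' = - z1' l1 / y1' l1 powr c"
  have "c \<noteq> 0" using c by auto
  note j = junction_balance[OF J pos \<open>c \<noteq> 0\<close>, folded R_def]
  note j' = junction_balance[OF J' pos \<open>c \<noteq> 0\<close>, folded R'_def]
  note mono = balance_strict_mono[OF phase_exponent_pos[OF c] pos(1,2) mult_pos_pos[OF pos(1,3)] mult_pos_pos[OF pos(2,4)]]
  have "c * R\<^sup>2 = c * R'\<^sup>2"
    using mono[of "c * R\<^sup>2" "c * R'\<^sup>2"] mono[of "c * R'\<^sup>2" "c * R\<^sup>2"] j j'
    by (cases "c * R\<^sup>2" "c * R'\<^sup>2" rule: linorder_cases) auto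
  then have R: "R = R'" using \<open>c \<noteq> 0\<close> j(1) j'(1) by simp
  have arcs: "power_arc c \<alpha>1 0 l1 y1 z1" "z1 0 = 0" "power_arc c (- \<alpha>2) 0 l2 y2 z2" "z2 0 = 0"
    "power_arc c \<alpha>1 0 l1 y1' z1'" "z1' 0 = 0" "power_arc c (- \<alpha>2) 0 l2 y2' z2'" "z2' 0 = 0"
    using J J' by (auto simp: junction_def)
  have ypos: "y1 l1 > 0" "y1' l1 > 0" "y1 0 > 0" "y1' 0 > 0" "y2 0 > 0" "y2' 0 > 0"
    using power_arcD(1)[OF arcs(1)] power_arcD(1)[OF arcs(3)] power_arcD(1)[OF arcs(5)] power_arcD(1)[OF arcs(7)] pos by auto
  have "y1 l1 powr (c - 1) = y1' l1 powr (c - 1)"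
    using j(5) j'(5) R pos by (metis less_irrefl mult_left_cancel)
  then have "y1 l1 = y1' l1" using powr_inject_base[of "y1 l1" "c - 1" "y1' l1"] ypos c by auto
  then have "y1 0 powr (2 * c) = y1' 0 powr (2 * c)" "y2 0 powr (2 * c) = y2' 0 powr (2 * c)"
    using j(6,7) j'(6,7) R by auto
  then have "y1 0 = y1' 0" "y2 0 = y2' 0"
    using powr_inject_base[of _ "2 * c"] ypos \<open>c \<noteq> 0\<close> by auto
  then show "t \<in> {0..l1} \<Longrightarrow> y1 t = y1' t" "t \<in> {0..l2} \<Longrightarrow> y2 t = y2' t"
    using power_arc_unique[OF arcs(1,2,5,6)] power_arc_unique[OF arcs(3,4,7,8)] pos \<open>c \<noteq> 0\<close> by auto
qed

text \<open>
  A root of \<open>balance\<close> with the sign of \<open>c\<close> is of the form \<open>c R\<^sup>2\<close>. The value at the meeting point is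
  chosen so that the first arc has length \<open>l1\<close>; that the second one has length \<open>l2\<close> is the balance
  equation.
\<close>
lemma junction_exists:
  assumes pos: "\<alpha>1 > 0" "\<alpha>2 > 0" "l1 > 0" "l2 > 0" and c: "c \<le> -1 \<or> c > 1"
    and sign: "c * (\<alpha>1 * l1 - \<alpha>2 * l2) < 0"
  obtains y1 z1 y2 z2 where "junction c \<alpha>1 \<alpha>2 l1 l2 y1 z1 y2 z2"
proof -
  define \<beta> where "\<beta> = phase_exponent c"
  have "c \<noteq> 0" "c \<noteq> 1" using c by auto
  have \<beta>: "0 < \<beta>" "\<beta> \<le> 1"
    using c phase_exponent_pos[of c] by (auto simp: \<beta>_def phase_exponent_def divide_le_eq)
  obtain \<xi> where \<xi>: "- \<alpha>1 < \<xi>" "\<xi> < \<alpha>2" "c * \<xi> > 0"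
      and root: "balance \<beta> \<alpha>1 \<alpha>2 (\<alpha>1 * l1) (\<alpha>2 * l2) \<xi> = 0"
    using balance_root_exists[OF \<beta> pos(1,2) mult_pos_pos[OF pos(1,3)] mult_pos_pos[OF pos(2,4)] sign] .
  define R where "R = sqrt (\<xi> / c)"
  have "\<xi> / c > 0" using \<xi>(3) by (auto simp: zero_less_divide_iff zero_less_mult_iff)
  then have R: "R > 0" "c * R\<^sup>2 = \<xi>" using \<open>c \<noteq> 0\<close> by (auto simp: R_def)
  have x: "c * \<alpha>1 * (R / \<alpha>1)\<^sup>2 = \<xi> / \<alpha>1" "c * (- \<alpha>2) * (R / \<alpha>2)\<^sup>2 = - \<xi> / \<alpha>2"
    using pos R(2) by (auto simp: power2_eq_square)
  define P where "P = time_ratio \<beta> (\<xi> / \<alpha>1)"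
  define Q where "Q = time_ratio \<beta> (- \<xi> / \<alpha>2)"
  have dom: "1 + \<xi> / \<alpha>1 > 0" "1 + - \<xi> / \<alpha>2 > 0" using \<xi> pos by (auto simp: field_simps)
  have "P > 0" using dom time_ratio_pos[of "\<xi> / \<alpha>1"] by (simp add: P_def)
  \<comment> \<open>\<open>U\<close> will be \<open>Y\<^sup>c\<^sup>-\<^sup>1\<close>, solved from the time map of the first arc.\<close>
  define U where "U = R * P / (\<alpha>1 * l1)"
  have "U > 0" using \<open>P > 0\<close> R pos by (simp add: U_def)
  define Y where "Y = U powr (1 / (c - 1))"
  have "Y > 0" and YU: "Y powr (c - 1) = U" using \<open>U > 0\<close> \<open>c \<noteq> 1\<close> by (auto simp: Y_def powr_powr)
  have eq: "\<alpha>1 * l1 * Q = \<alpha>2 * l2 * P" using root by (simp add: balance_def P_def Q_def)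
  have t1: "l1 * Y powr (c - 1) = R / \<alpha>1 * P" using pos by (simp add: YU U_def)
  have t2: "l2 * Y powr (c - 1) = R / \<alpha>2 * Q"
  proof -
    have "\<alpha>2 * (\<alpha>1 * l1) * (l2 * U) = \<alpha>2 * l2 * P * R" using pos by (simp add: U_def)
    also have "\<dots> = \<alpha>2 * (\<alpha>1 * l1) * (R / \<alpha>2 * Q)"
      using pos unfolding eq[symmetric] by simp
    finally show ?thesis using pos by (simp add: YU field_simps)
  qed
  obtain y1 z1 where 1: "power_arc c \<alpha>1 0 l1 y1 z1" "z1 0 = 0" "y1 l1 = Y" "z1 l1 = - \<alpha>1 * (R / \<alpha>1) * Y powr c"
    using power_arc_exists[of c \<alpha>1 l1 Y "R / \<alpha>1"] \<open>c \<noteq> 0\<close> pos \<open>Y > 0\<close> R dom t1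
    unfolding x P_def \<beta>_def by auto
  obtain y2 z2 where 2: "power_arc c (- \<alpha>2) 0 l2 y2 z2" "z2 0 = 0" "y2 l2 = Y" "z2 l2 = - (- \<alpha>2) * (R / \<alpha>2) * Y powr c"
    using power_arc_exists[of c "- \<alpha>2" l2 Y "R / \<alpha>2"] \<open>c \<noteq> 0\<close> pos \<open>Y > 0\<close> R dom t2
    unfolding x Q_def \<beta>_def by auto
  have "junction c \<alpha>1 \<alpha>2 l1 l2 y1 z1 y2 z2"
    using 1 2 pos by (simp add: junction_def)
  then show ?thesis using that by blast
qed

section \<open>Symmetry of arcs with equal end values\<close>
text \<open>
  Equal initial and end values force equal squares of the final slope variables, which are positive, so they
  are equal, and \<open>power_arc_phase_time\<close> then recovers the duration.
\<close>
lemma power_arc_length_unique: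
  assumes 1: "power_arc c b 0 L1 y1 z1" "z1 0 = 0" and 2: "power_arc c b 0 L2 y2 z2" "z2 0 = 0"
    and "y1 0 = y2 0" "y1 L1 = y2 L2" "c \<noteq> 0" "b \<noteq> 0" "L1 > 0" "L2 > 0"
  shows "L1 = L2"
proof -
  let ?r1 = "- z1 L1 / (b * y1 L1 powr c)" and ?r2 = "- z2 L2 / (b * y2 L2 powr c)"
  have L: "L1 \<in> {0..L1}" "L2 \<in> {0..L2}" using assms by auto
  have y: "y1 L1 > 0" "y1 0 > 0" using power_arcD(1)[OF 1(1)] \<open>L1 > 0\<close> by auto
  note i1 = power_arc_slope_invariant(1)[OF 1 \<open>c \<noteq> 0\<close> \<open>b \<noteq> 0\<close> L(1)]
  note i2 = power_arc_slope_invariant(1)[OF 2 \<open>c \<noteq> 0\<close> \<open>b \<noteq> 0\<close> L(2)]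
  have "y1 L1 powr (2 * c) * (1 + c * b * ?r1\<^sup>2) = y1 L1 powr (2 * c) * (1 + c * b * ?r2\<^sup>2)"
    using i1 i2 assms by simp
  moreover have "y1 L1 powr (2 * c) \<noteq> 0" using y by simp
  ultimately have "1 + c * b * ?r1\<^sup>2 = 1 + c * b * ?r2\<^sup>2"
    by (rule mult_left_cancel[THEN iffD1, rotated])
  then have "?r1\<^sup>2 = ?r2\<^sup>2" using assms by simp
  moreover have "?r1 > 0" "?r2 > 0" using power_arc_time_map(1)[OF 1] power_arc_time_map(1)[OF 2] assms by auto
  ultimately have "?r1 = ?r2" by (meson less_imp_le power2_eq_imp_eq)
  then have "y1 0 powr (c - 1) * L1 = y2 0 powr (c - 1) * L2"
    using power_arc_phase_time[OF 1 \<open>c \<noteq> 0\<close> \<open>b \<noteq> 0\<close> L(1)] power_arc_phase_time[OF 2 \<open>c \<noteq> 0\<close> \<open>b \<noteq> 0\<close> L(2)] by simp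
  then show ?thesis using y assms by simp
qed

text \<open>
  By Rolle the slope vanishes somewhere inside. The two arcs that leave this point in opposite
  directions have the same initial and end values, so they have the same length and coincide.
\<close>
lemma power_arc_symmetric:
  assumes arc: "power_arc c b p q y z" and "p < q" "y p = y q" "c \<noteq> 0" "b \<noteq> 0"
  defines "m \<equiv> (p + q) / 2"
  shows "z m = 0" and "\<And>s. s \<in> {0..(q - p) / 2} \<Longrightarrow> y (m - s) = y (m + s)"
proof -
  have at: "at t within {p..q} = at t" if "p < t" "t < q" for t
    using that by (simp add: at_within_Icc_at)
  have "\<exists>t. p < t \<and> t < q \<and> DERIV y t :> 0"
  proof (rule Rolle[OF \<open>p < q\<close> \<open>y p = y q\<close>])
    show "continuous_on {p..q} y" using power_arcD(2)[OF arc] by (rule DERIV_continuous_on)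
    show "y differentiable (at t)" if "p < t" "t < q" for t
      using power_arcD(2)[OF arc, of t] at[OF that] that by (auto simp: real_differentiable_def)
  qed
  then obtain t where t: "p < t" "t < q" "DERIV y t :> 0" by blast
  then have zt: "z t = 0" using power_arcD(2)[OF arc, of t] at[OF t(1,2)] DERIV_unique by fastforce
  have R: "power_arc c b 0 (q - t) (\<lambda>s. y (t + s)) (\<lambda>s. z (t + s))"
    using power_arc_translate[OF power_arc_subset[OF arc, of t q], of "- t"] t by (simp add: add.commute)
  have L: "power_arc c b 0 (t - p) (\<lambda>s. y (t - s)) (\<lambda>s. - z (t - s))"
    using power_arc_reflect[OF power_arc_subset[OF arc, of p t], of t] t by simp
  have "q - t = t - p"
    by (rule power_arc_length_unique[OF R _ L]) (use zt assms t in auto)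
  then have tm: "t = m" by (simp add: m_def field_simps)
  then show "z m = 0" using zt by simp
  fix s assume s: "s \<in> {0..(q - p) / 2}"
  have "t - p = (q - p) / 2" "q - t = (q - p) / 2" using tm by (auto simp: m_def field_simps)
  then have "y (t - s) = y (t + s)"
    using power_arc_unique[OF L _ R[unfolded \<open>q - t = t - p\<close>], of s] zt assms s by simp
  then show "y (m - s) = y (m + s)" by (simp add: tm)
qed

section \<open>Positive solutions as pairs of arcs\<close>
lemma power_arc_velocity_Lipschitz:
  assumes arc: "power_arc c b p q y z"
  obtains M where "\<And>s t. s \<in> {p..q} \<Longrightarrow> t \<in> {p..q} \<Longrightarrow> \<bar>z s - z t\<bar> \<le> M * \<bar>s - t\<bar>"
proof -
  have "continuous_on {p..q} y" using power_arcD(2)[OF arc] by (rule DERIV_continuous_on)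
  then have "continuous_on {p..q} (\<lambda>t. - b * y t powr (2 * c - 1))"
    using power_arcD(1)[OF arc] by (intro continuous_intros) force+
  then have "bounded ((\<lambda>t. - b * y t powr (2 * c - 1)) ` {p..q})"
    by (intro compact_imp_bounded compact_continuous_image) auto
  then obtain M where M: "\<And>t. t \<in> {p..q} \<Longrightarrow> norm (- b * y t powr (2 * c - 1)) \<le> M"
    unfolding bounded_iff by blast
  have "norm (z s - z t) \<le> M * norm (s - t)" if "s \<in> {p..q}" "t \<in> {p..q}" for s t
    by (rule field_differentiable_bound[OF _ power_arcD(3)[OF arc] M that]) auto
  then show ?thesis using that[of M] by simp
qed

lemma deriv_upto_eq:
  assumes "(f has_real_derivative D) (at t within {0..T})" "t \<in> {0..T}" "0 < T"
  shows "deriv_upto T f t = D"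
  using assms unfolding deriv_upto_def
  by (intro vector_derivative_within_closed_interval)
     (auto simp: has_real_derivative_iff_has_vector_derivative)

text \<open>
  Where the coefficient is constant, the almost everywhere defined second derivative of a solution is
  a continuous function, so the integral form of the equation shows that it exists everywhere.
\<close>
lemma positive_solution_imp_power_arc:
  assumes sol: "positive_solution T a (2 * c - 1) u" and "0 \<le> p" "p < q" "q \<le> T"
    and a: "\<And>t. t \<in> {p..<q} \<Longrightarrow> a t = b"
  shows "power_arc c b p q u (deriv_upto T u)"
proof -
  let ?v = "deriv_upto T u" and ?g = "\<lambda>t. - b * u t powr (2 * c - 1)"
  have upos: "u t > 0" if "t \<in> {0..T}" for t
    using sol that by (auto simp: positive_solution_def)
  have du: "(u has_real_derivative ?v t) (at t within {0..T})" if "t \<in> {0..T}" for t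
    using sol that unfolding positive_solution_def deriv_upto_def
    by (auto simp: differentiable_on_def has_real_derivative_iff_has_vector_derivative
        vector_derivative_works[symmetric])
  have sub: "{p..q} \<subseteq> {0..T}" using assms by auto
  have du': "(u has_real_derivative ?v t) (at t within {p..q})" if "t \<in> {p..q}" for t
    using du[of t] sub that by (meson DERIV_subset subsetD)
  have "AE t in lebesgue_on {0..T}. ?v differentiable (at t within {0..T}) \<and>
        deriv_upto T ?v t + a t * u t powr (2 * c - 1) = 0"
    using sol unfolding positive_solution_def by blast
  then have "AE t in lebesgue. t \<in> {0..T} \<longrightarrow> ?v differentiable (at t within {0..T}) \<and>
        deriv_upto T ?v t + a t * u t powr (2 * c - 1) = 0"
    by (rule AE_restrict_space_iff[THEN iffD1, rotated]) simp
  then obtain N where N: "N \<in> null_sets lebesgue"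
    and ode: "\<And>t. t \<in> {0..T} - N \<Longrightarrow> ?v differentiable (at t within {0..T}) \<and>
        deriv_upto T ?v t + a t * u t powr (2 * c - 1) = 0"
    unfolding eventually_ae_filter by auto
  have dv: "(?v has_real_derivative ?g t) (at t within {p..q})" if "t \<in> {p..q} - (insert q N)" for t
  proof -
    have t: "t \<in> {0..T} - N" "t \<in> {p..<q}" using that sub by auto
    have "(?v has_vector_derivative deriv_upto T ?v t) (at t within {0..T})"
      using ode[OF t(1)] unfolding deriv_upto_def[of T "deriv_upto T u"]
      by (simp add: vector_derivative_works[symmetric])
    moreover have "deriv_upto T ?v t = ?g t" using ode[OF t(1)] a[OF t(2)] by simp
    ultimately show ?thesis
      using sub by (metis DERIV_subset has_real_derivative_iff_has_vector_derivative)
  qed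
  have "continuous_on {p..q} u" using du' by (rule DERIV_continuous_on)
  moreover have "u t \<noteq> 0" if "t \<in> {p..q}" for t using upos[of t] sub that by auto
  ultimately have cont: "continuous_on {p..q} ?g" by (intro continuous_intros) auto
  have negl: "negligible (insert q N)" using N by (simp add: negligible_iff_null_sets[symmetric])
  have int: "?v s = ?v p + integral {p..s} ?g" if "s \<in> {p..q}" for s
  proof -
    have "abs_continuous_on {p..s} ?v"
      using sol abs_continuous_on_subset[of "{0..T}" ?v "{p..s}"] sub that
      by (auto simp: positive_solution_def)
    then have "(?g has_integral (?v s - ?v p)) {p..s}"
    proof (rule has_integral_abs_continuous[rotated, OF _ negl])
      fix t assume "t \<in> {p..s} - insert q N"
      then show "(?v has_real_derivative ?g t) (at t within {p..s})"
        using dv[of t] that by (auto intro: DERIV_subset)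
    qed (use that in simp)
    then have "integral {p..s} ?g = ?v s - ?v p" by (rule integral_unique)
    then show ?thesis by linarith
  qed
  show ?thesis
    unfolding power_arc_def
  proof (intro ballI conjI)
    fix t assume t: "t \<in> {p..q}"
    show "u t > 0" using upos t sub by blast
    show "(u has_real_derivative ?v t) (at t within {p..q})" by (rule du'[OF t])
    have "((\<lambda>s. integral {p..s} ?g) has_real_derivative ?g t) (at t within {p..q})"
      unfolding has_real_derivative_iff_has_vector_derivative
      by (rule integral_has_vector_derivative[OF cont t])
    from DERIV_add[OF DERIV_const[of "?v p"] this]
    have "((\<lambda>s. ?v p + integral {p..s} ?g) has_real_derivative ?g t) (at t within {p..q})"
      by (simp only: add_0)
    then show "(?v has_real_derivative ?g t) (at t within {p..q})"
      by (rule has_field_derivative_transform_within[OF _ zero_less_one t]) (erule int[symmetric])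
  qed
qed

text \<open>
  Conversely, the derivative of a function composed of two classical arcs is Lipschitz, hence
  absolutely continuous, and the equation holds at all points other than \<open>\<tau>\<close> and \<open>T\<close>.
\<close>
lemma positive_solution_of_power_arcs:
  assumes \<tau>: "0 < \<tau>" "\<tau> < T"
    and a1: "\<forall>t\<in>{0..<\<tau>}. a t = b1" and a2: "\<forall>t\<in>{\<tau>..<T}. a t = b2"
    and ext: "u \<in> extensional {0..T}"
    and arc1: "power_arc c b1 0 \<tau> u v" and arc2: "power_arc c b2 \<tau> T u v"
  shows "positive_solution T a (2 * c - 1) u" "\<And>t. t \<in> {0..T} \<Longrightarrow> deriv_upto T u t = v t"
proof -
  have du: "(u has_real_derivative v t) (at t within {0..T})" for t
    by (rule has_real_derivative_join[OF power_arcD(2)[OF arc1] power_arcD(2)[OF arc2]]) (use \<tau> in auto)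
  show dt: "deriv_upto T u t = v t" if "t \<in> {0..T}" for t
    using deriv_upto_eq[OF du that] \<tau> by simp
  obtain M1 where M1: "\<And>s t. s \<in> {0..\<tau>} \<Longrightarrow> t \<in> {0..\<tau>} \<Longrightarrow> \<bar>v s - v t\<bar> \<le> M1 * \<bar>s - t\<bar>"
    using power_arc_velocity_Lipschitz[OF arc1] by blast
  obtain M2 where M2: "\<And>s t. s \<in> {\<tau>..T} \<Longrightarrow> t \<in> {\<tau>..T} \<Longrightarrow> \<bar>v s - v t\<bar> \<le> M2 * \<bar>s - t\<bar>"
    using power_arc_velocity_Lipschitz[OF arc2] by blast
  have ord: "\<bar>v s - v t\<bar> \<le> max M1 M2 * \<bar>s - t\<bar>" if "0 \<le> s" "s \<le> t" "t \<le> T" for s t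
  proof -
    \<comment> \<open>\<open>w\<close> splits \<open>[s,t]\<close> at \<open>\<tau>\<close> if \<open>\<tau>\<close> lies in it; otherwise it is an endpoint of \<open>[s,t]\<close>.\<close>
    define w where "w = max s (min \<tau> t)"
    have "\<bar>v s - v w\<bar> \<le> max M1 M2 * (w - s)"
    proof (cases "s \<le> \<tau>")
      case True
      then have "\<bar>v s - v w\<bar> \<le> M1 * (w - s)" using M1[of s w] that by (auto simp: w_def)
      also have "\<dots> \<le> max M1 M2 * (w - s)" by (intro mult_right_mono) (auto simp: w_def)
      finally show ?thesis .
    qed (auto simp: w_def)
    moreover have "\<bar>v w - v t\<bar> \<le> max M1 M2 * (t - w)"
    proof (cases "\<tau> \<le> t")
      case True
      then have "\<bar>v w - v t\<bar> \<le> M2 * (t - w)" using M2[of w t] that \<tau> by (auto simp: w_def)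
      also have "\<dots> \<le> max M1 M2 * (t - w)" using that by (intro mult_right_mono) (auto simp: w_def)
      finally show ?thesis .
    next
      case False
      then have "w = t" using that by (simp add: w_def)
      then show ?thesis by simp
    qed
    ultimately have "\<bar>v s - v t\<bar> \<le> max M1 M2 * (w - s) + max M1 M2 * (t - w)" by linarith
    also have "\<dots> = max M1 M2 * \<bar>s - t\<bar>" using that by (simp add: algebra_simps)
    finally show ?thesis .
  qed
  have lip: "\<bar>deriv_upto T u s - deriv_upto T u t\<bar> \<le> max M1 M2 * \<bar>s - t\<bar>"
    if "s \<in> {0..T}" "t \<in> {0..T}" for s t
    using ord[of s t] ord[of t s] that
    by (cases "s \<le> t") (auto simp: dt abs_minus_commute)
  have ac: "abs_continuous_on {0..T} (deriv_upto T u)"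
    by (rule Lipschitz_imp_abs_continuous_on[OF lip])
  have dv: "deriv_upto T u differentiable (at t within {0..T}) \<and>
      deriv_upto T (deriv_upto T u) t + a t * u t powr (2 * c - 1) = 0"
    if "t \<in> {0..T}" "t \<notin> {\<tau>, T}" for t
  proof -
    have "(v has_real_derivative - a t * u t powr (2 * c - 1)) (at t within {0..T})"
    proof (rule has_real_derivative_join[where m = \<tau>])
      show "(v has_real_derivative - a t * u t powr (2 * c - 1)) (at t within {0..\<tau>})" if "t \<in> {0..\<tau>}"
        using power_arcD(3)[OF arc1 that] bspec[OF a1, of t] that \<open>t \<notin> {\<tau>, T}\<close> by simp
      show "(v has_real_derivative - a t * u t powr (2 * c - 1)) (at t within {\<tau>..T})" if "t \<in> {\<tau>..T}"
        using power_arcD(3)[OF arc2 that] bspec[OF a2, of t] that \<open>t \<notin> {\<tau>, T}\<close> by simp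
    qed (use \<tau> in auto)
    then have d: "(deriv_upto T u has_real_derivative - a t * u t powr (2 * c - 1)) (at t within {0..T})"
      by (rule has_field_derivative_transform_within[OF _ zero_less_one that(1)]) (simp add: dt)
    then show ?thesis
      using deriv_upto_eq[OF d that(1)] \<tau> by (auto simp: real_differentiable_def)
  qed
  have "{\<tau>, T} \<in> null_sets lebesgue"
    using negligible_iff_null_sets[of "{\<tau>, T}"] by simp
  then have "AE t in lebesgue. t \<notin> {\<tau>, T}" by (rule AE_not_in)
  then have "AE t in lebesgue. t \<in> {0..T} \<longrightarrow> deriv_upto T u differentiable (at t within {0..T}) \<and>
      deriv_upto T (deriv_upto T u) t + a t * u t powr (2 * c - 1) = 0"
    by (rule eventually_mono) (use dv in blast)
  then have ae: "AE t in lebesgue_on {0..T}. deriv_upto T u differentiable (at t within {0..T}) \<and>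
      deriv_upto T (deriv_upto T u) t + a t * u t powr (2 * c - 1) = 0"
    by (rule AE_restrict_space_iff[THEN iffD2, rotated]) simp
  have "u t > 0" if "t \<in> {0..T}" for t
    using power_arcD(1)[OF arc1, of t] power_arcD(1)[OF arc2, of t] that by force
  then have "u \<in> {0..T} \<rightarrow>\<^sub>E {0<..}" using ext by (auto simp: PiE_def)
  moreover have "u differentiable_on {0..T}"
    using du by (auto simp: differentiable_on_def real_differentiable_def)
  moreover have "continuous_on {0..T} (deriv_upto T u)"
  proof -
    have "\<bar>deriv_upto T u s - deriv_upto T u t\<bar> \<le> \<bar>max M1 M2\<bar> * \<bar>s - t\<bar>"
      if "s \<in> {0..T}" "t \<in> {0..T}" for s t
      using lip[OF that] mult_right_mono[OF abs_ge_self abs_ge_zero, of "max M1 M2" "s - t"] by linarith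
    then have "(\<bar>max M1 M2\<bar>)-lipschitz_on {0..T} (deriv_upto T u)"
      by (intro lipschitz_onI) (auto simp: dist_real_def)
    then show ?thesis by (rule lipschitz_on_continuous_on)
  qed
  ultimately show "positive_solution T a (2 * c - 1) u"
    using ac ae by (simp add: positive_solution_def)
qed

section \<open>The Neumann and the periodic problem\<close>
definition stepwise_weight :: "real \<Rightarrow> real \<Rightarrow> real \<Rightarrow> real \<Rightarrow> (real \<Rightarrow> real) \<Rightarrow> bool" where
  "stepwise_weight \<alpha>1 \<alpha>2 \<tau> T a \<longleftrightarrow> 0 < \<tau> \<and> \<tau> < T \<and> 0 < \<alpha>1 \<and> 0 < \<alpha>2 \<and>
     (\<forall>t\<in>{0..<\<tau>}. a t = \<alpha>1) \<and> (\<forall>t\<in>{\<tau>..<T}. a t = - \<alpha>2)"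

lemma stepwise_weightD:
  assumes "stepwise_weight \<alpha>1 \<alpha>2 \<tau> T a"
  shows "0 < \<tau>" "\<tau> < T" "\<alpha>1 > 0" "\<alpha>2 > 0"
    "\<forall>t\<in>{0..<\<tau>}. a t = \<alpha>1" "\<forall>t\<in>{\<tau>..<T}. a t = - \<alpha>2"
  using assms by (auto simp: stepwise_weight_def)

lemma neumann_solution_imp_junction:
  assumes sol: "neumann_solution T a (2 * c - 1) u" and W: "stepwise_weight \<alpha>1 \<alpha>2 \<tau> T a"
  shows "junction c \<alpha>1 \<alpha>2 \<tau> (T - \<tau>) u (deriv_upto T u)
    (\<lambda>s. u (T - s)) (\<lambda>s. - deriv_upto T u (T - s))"
proof -
  note \<tau> = stepwise_weightD(1,2)[OF W] and pos = stepwise_weightD(3,4)[OF W]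
    and a = stepwise_weightD(5,6)[OF W]
  have ps: "positive_solution T a (2 * c - 1) u" and "deriv_upto T u 0 = 0" "deriv_upto T u T = 0"
    using sol by (auto simp: neumann_solution_def)
  moreover have "power_arc c \<alpha>1 0 \<tau> u (deriv_upto T u)"
    by (rule positive_solution_imp_power_arc[OF ps]) (use \<tau> a in auto)
  moreover have "power_arc c (- \<alpha>2) \<tau> T u (deriv_upto T u)"
    by (rule positive_solution_imp_power_arc[OF ps]) (use \<tau> a in auto)
  ultimately show ?thesis
    using power_arc_reflect[of c "- \<alpha>2" \<tau> T u "deriv_upto T u" T] by (simp add: junction_def)
qed

lemma neumann_solution_unique:
  assumes sol: "neumann_solution T a (2 * c - 1) u" "neumann_solution T a (2 * c - 1) w"
    and W: "stepwise_weight \<alpha>1 \<alpha>2 \<tau> T a" and c: "c < 0 \<or> c > 1"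
  shows "u = w"
proof (rule extensionalityI)
  note \<tau> = stepwise_weightD(1,2)[OF W] and pos = stepwise_weightD(3,4)[OF W]
    and a = stepwise_weightD(5,6)[OF W]
  show "u \<in> extensional {0..T}" "w \<in> extensional {0..T}"
    using sol by (simp_all add: neumann_solution_def positive_solution_def PiE_def)
  fix t assume t: "t \<in> {0..T}"
  have l: "T - \<tau> > 0" using \<tau> by simp
  note J = junction_unique[OF neumann_solution_imp_junction[OF sol(1) W]
      neumann_solution_imp_junction[OF sol(2) W] pos \<tau>(1) l c]
  show "u t = w t" using J(1)[of t] J(2)[of "T - t"] t by (cases "t \<le> \<tau>") auto
qed

text \<open>
  The first arc followed by the time reversal of the second one.
\<close>
lemma neumann_solution_exists:
  assumes J: "junction c \<alpha>1 \<alpha>2 \<tau> (T - \<tau>) y1 z1 y2 z2" and W: "stepwise_weight \<alpha>1 \<alpha>2 \<tau> T a"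
  shows "\<exists>u. neumann_solution T a (2 * c - 1) u"
proof -
  note \<tau> = stepwise_weightD(1,2)[OF W] and pos = stepwise_weightD(3,4)[OF W]
    and a = stepwise_weightD(5,6)[OF W]
  define u where "u = restrict (\<lambda>t. if t \<le> \<tau> then y1 t else y2 (T - t)) {0..T}"
  define v where "v = (\<lambda>t. if t \<le> \<tau> then z1 t else - z2 (T - t))"
  have arcs: "power_arc c \<alpha>1 0 \<tau> y1 z1" "z1 0 = 0" "power_arc c (- \<alpha>2) 0 (T - \<tau>) y2 z2" "z2 0 = 0"
    and m: "y1 \<tau> = y2 (T - \<tau>)" "z1 \<tau> = - z2 (T - \<tau>)"
    using J by (auto simp: junction_def)
  have 1: "power_arc c \<alpha>1 0 \<tau> u v"
    by (rule power_arc_cong[OF arcs(1)]) (use \<tau> in \<open>auto simp: u_def v_def\<close>)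
  have "power_arc c (- \<alpha>2) \<tau> T (\<lambda>t. y2 (T - t)) (\<lambda>t. - z2 (T - t))"
    using power_arc_reflect[OF arcs(3), of T] by simp
  then have 2: "power_arc c (- \<alpha>2) \<tau> T u v"
    by (rule power_arc_cong) (use \<tau> m in \<open>auto simp: u_def v_def not_le\<close>)
  have ext: "u \<in> extensional {0..T}" by (simp add: u_def)
  note ps = positive_solution_of_power_arcs[OF \<tau> a ext 1 2]
  then have "neumann_solution T a (2 * c - 1) u"
    using \<tau> arcs by (simp add: neumann_solution_def v_def)
  then show ?thesis by blast
qed

text \<open>
  Conservation of energy on \<open>[0,\<tau>]\<close> and on \<open>[\<tau>,T]\<close>, together with periodicity, gives two
  equations whose difference forces \<open>u(0) = u(\<tau>)\<close>. So \<open>u\<close> takes equal values at the ends of each of the two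
  intervals and is symmetric about their midpoints; the part between the midpoints is a junction of
  arcs with half the lengths.
\<close>
lemma periodic_solution_symmetric:
  assumes sol: "periodic_solution T a (2 * c - 1) u" and W: "stepwise_weight \<alpha>1 \<alpha>2 \<tau> T a" and "c \<noteq> 0"
  defines "m1 \<equiv> \<tau> / 2" and "m2 \<equiv> (\<tau> + T) / 2"
  shows "\<And>s. s \<in> {0..\<tau> / 2} \<Longrightarrow> u (m1 - s) = u (m1 + s)"
    and "\<And>s. s \<in> {0..(T - \<tau>) / 2} \<Longrightarrow> u (m2 - s) = u (m2 + s)"
    and "junction c \<alpha>1 \<alpha>2 (\<tau> / 2) ((T - \<tau>) / 2) (\<lambda>s. u (m1 + s)) (\<lambda>s. deriv_upto T u (m1 + s))
      (\<lambda>s. u (m2 - s)) (\<lambda>s. - deriv_upto T u (m2 - s))"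
proof -
  note \<tau> = stepwise_weightD(1,2)[OF W] and pos = stepwise_weightD(3,4)[OF W]
    and a = stepwise_weightD(5,6)[OF W]
  let ?v = "deriv_upto T u"
  have ps: "positive_solution T a (2 * c - 1) u" and per: "u T = u 0" "?v T = ?v 0"
    using sol by (auto simp: periodic_solution_def)
  have arc1: "power_arc c \<alpha>1 0 \<tau> u ?v"
    by (rule positive_solution_imp_power_arc[OF ps]) (use \<tau> a in auto)
  have arc2: "power_arc c (- \<alpha>2) \<tau> T u ?v"
    by (rule positive_solution_imp_power_arc[OF ps]) (use \<tau> a in auto)
  have "(?v 0)\<^sup>2 + \<alpha>1 / c * u 0 powr (2 * c) = (?v \<tau>)\<^sup>2 + \<alpha>1 / c * u \<tau> powr (2 * c)"
    using power_arc_energy[OF arc1] \<tau> \<open>c \<noteq> 0\<close> by simp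
  moreover have "(?v \<tau>)\<^sup>2 - \<alpha>2 / c * u \<tau> powr (2 * c) = (?v 0)\<^sup>2 - \<alpha>2 / c * u 0 powr (2 * c)"
    using power_arc_energy[OF arc2] \<tau> \<open>c \<noteq> 0\<close> per by simp
  ultimately have "(\<alpha>1 + \<alpha>2) / c * (u 0 powr (2 * c) - u \<tau> powr (2 * c)) = 0"
    by (simp add: algebra_simps add_divide_distrib)
  then have "u 0 powr (2 * c) = u \<tau> powr (2 * c)" using pos \<open>c \<noteq> 0\<close> by auto
  then have eq: "u 0 = u \<tau>"
    using powr_inject_base[of "u 0" "2 * c" "u \<tau>"] power_arcD(1)[OF arc1] \<tau> \<open>c \<noteq> 0\<close> by simp
  have m: "(0 + \<tau>) / 2 = m1" "\<tau> - 0 = \<tau>" by (auto simp: m1_def)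
  note s1 = power_arc_symmetric[OF arc1 \<tau>(1) eq \<open>c \<noteq> 0\<close>, unfolded m]
  note s2 = power_arc_symmetric[OF arc2 \<tau>(2) _ \<open>c \<noteq> 0\<close>, folded m2_def]
  show "\<And>s. s \<in> {0..\<tau> / 2} \<Longrightarrow> u (m1 - s) = u (m1 + s)" using s1(2) pos by simp
  show "\<And>s. s \<in> {0..(T - \<tau>) / 2} \<Longrightarrow> u (m2 - s) = u (m2 + s)" using s2(2) pos eq per by simp
  have z: "?v m1 = 0" "?v m2 = 0" using s1(1) s2(1) pos eq per by auto
  have ends: "m1 + \<tau> / 2 = \<tau>" "m2 - (T - \<tau>) / 2 = \<tau>" "\<tau> - m1 = \<tau> / 2" "m2 - \<tau> = (T - \<tau>) / 2"
    by (auto simp: m1_def m2_def field_simps)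
  have "power_arc c \<alpha>1 0 (\<tau> / 2) (\<lambda>s. u (m1 + s)) (\<lambda>s. ?v (m1 + s))"
    using power_arc_translate[OF power_arc_subset[OF arc1, of m1 \<tau>], of "- m1"] \<tau>
    by (simp add: ends add.commute) (simp add: m1_def)
  moreover have "power_arc c (- \<alpha>2) 0 ((T - \<tau>) / 2) (\<lambda>s. u (m2 - s)) (\<lambda>s. - ?v (m2 - s))"
    using power_arc_reflect[OF power_arc_subset[OF arc2, of \<tau> m2], of m2] \<tau>
    by (simp add: ends) (simp add: m2_def)
  ultimately show "junction c \<alpha>1 \<alpha>2 (\<tau> / 2) ((T - \<tau>) / 2) (\<lambda>s. u (m1 + s)) (\<lambda>s. ?v (m1 + s))
      (\<lambda>s. u (m2 - s)) (\<lambda>s. - ?v (m2 - s))"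
    by (simp add: junction_def z ends)
qed

lemma periodic_solution_unique:
  assumes sol: "periodic_solution T a (2 * c - 1) u" "periodic_solution T a (2 * c - 1) w"
    and W: "stepwise_weight \<alpha>1 \<alpha>2 \<tau> T a" and c: "c < 0 \<or> c > 1"
  shows "u = w"
proof (rule extensionalityI)
  note \<tau> = stepwise_weightD(1,2)[OF W] and pos = stepwise_weightD(3,4)[OF W]
    and a = stepwise_weightD(5,6)[OF W]
  show "u \<in> extensional {0..T}" "w \<in> extensional {0..T}"
    using sol by (simp_all add: periodic_solution_def positive_solution_def PiE_def)
  have "c \<noteq> 0" using c by auto
  have l: "\<tau> / 2 > 0" "(T - \<tau>) / 2 > 0" using \<tau> by auto
  define m1 where "m1 = \<tau> / 2"
  define m2 where "m2 = (\<tau> + T) / 2"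
  note su = periodic_solution_symmetric[OF sol(1) W \<open>c \<noteq> 0\<close>, folded m1_def m2_def]
  note sw = periodic_solution_symmetric[OF sol(2) W \<open>c \<noteq> 0\<close>, folded m1_def m2_def]
  note J = junction_unique[OF su(3) sw(3) pos l[folded m1_def] c]
  have \<tau>m: "\<tau> = 2 * m1" by (simp add: m1_def)
  fix t assume t: "t \<in> {0..T}"
  show "u t = w t"
  proof (cases "t \<le> \<tau>")
    case True
    have s: "\<bar>t - m1\<bar> \<in> {0..m1}" using t True \<tau>m by (auto simp: abs_le_iff)
    then have "u (m1 + \<bar>t - m1\<bar>) = w (m1 + \<bar>t - m1\<bar>)" using J(1)[of "\<bar>t - m1\<bar>"] by blast
    moreover from this have "u (m1 - \<bar>t - m1\<bar>) = w (m1 - \<bar>t - m1\<bar>)" using su(1)[OF s] sw(1)[OF s] by simp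
    ultimately show ?thesis by (cases "t \<le> m1") auto
  next
    case False
    have s: "\<bar>t - m2\<bar> \<in> {0..(T - \<tau>) / 2}" using t False by (auto simp: m2_def abs_le_iff field_simps)
    then have "u (m2 - \<bar>t - m2\<bar>) = w (m2 - \<bar>t - m2\<bar>)" using J(2)[of "\<bar>t - m2\<bar>"] by blast
    moreover from this have "u (m2 + \<bar>t - m2\<bar>) = w (m2 + \<bar>t - m2\<bar>)" using su(2)[OF s] sw(2)[OF s] by simp
    ultimately show ?thesis by (cases "t \<le> m2") auto
  qed
qed

text \<open>
  Each arc of the junction is used twice: reflected at its starting point, where the slope vanishes.
\<close>
lemma periodic_solution_exists:
  assumes J: "junction c \<alpha>1 \<alpha>2 (\<tau> / 2) ((T - \<tau>) / 2) y1 z1 y2 z2" and W: "stepwise_weight \<alpha>1 \<alpha>2 \<tau> T a"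
  shows "\<exists>u. periodic_solution T a (2 * c - 1) u"
proof -
  note \<tau> = stepwise_weightD(1,2)[OF W] and pos = stepwise_weightD(3,4)[OF W]
    and a = stepwise_weightD(5,6)[OF W]
  define m1 where "m1 = \<tau> / 2"
  define m2 where "m2 = (\<tau> + T) / 2"
  define u where "u = restrict (\<lambda>t. if t \<le> \<tau> then y1 \<bar>t - m1\<bar> else y2 \<bar>t - m2\<bar>) {0..T}"
  define v where "v = (\<lambda>t. if t \<le> m1 then - z1 (m1 - t) else if t \<le> \<tau> then z1 (t - m1)
     else if t \<le> m2 then - z2 (m2 - t) else z2 (t - m2))"
  have ord: "0 < m1" "m1 < \<tau>" "\<tau> < m2" "m2 < T" using \<tau> by (auto simp: m1_def m2_def)
  have len: "\<tau> / 2 = m1" "(T - \<tau>) / 2 = m2 - \<tau>" by (auto simp: m1_def m2_def field_simps)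
  have \<tau>m: "\<tau> = 2 * m1" "T = 2 * m2 - \<tau>" by (simp_all add: m1_def m2_def add_divide_distrib distrib_left)
  have arcs: "power_arc c \<alpha>1 0 m1 y1 z1" "z1 0 = 0" "power_arc c (- \<alpha>2) 0 (m2 - \<tau>) y2 z2" "z2 0 = 0"
    and m: "y1 m1 = y2 (m2 - \<tau>)" "z1 m1 = - z2 (m2 - \<tau>)"
    using J by (auto simp: junction_def len)
  have "power_arc c \<alpha>1 0 m1 (\<lambda>t. y1 (m1 - t)) (\<lambda>t. - z1 (m1 - t))"
    using power_arc_reflect[OF arcs(1), of m1] by simp
  then have 1: "power_arc c \<alpha>1 0 m1 u v"
    by (rule power_arc_cong) (use ord in \<open>auto simp: u_def v_def\<close>)
  have "power_arc c \<alpha>1 m1 \<tau> (\<lambda>t. y1 (t - m1)) (\<lambda>t. z1 (t - m1))"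
    using power_arc_translate[OF arcs(1), of m1] by (simp add: \<tau>m(1))
  then have 2: "power_arc c \<alpha>1 m1 \<tau> u v"
    by (rule power_arc_cong) (use ord arcs in \<open>auto simp: u_def v_def\<close>)
  have "power_arc c (- \<alpha>2) \<tau> m2 (\<lambda>t. y2 (m2 - t)) (\<lambda>t. - z2 (m2 - t))"
    using power_arc_reflect[OF arcs(3), of m2] by simp
  then have 3: "power_arc c (- \<alpha>2) \<tau> m2 u v"
    by (rule power_arc_cong) (use ord m \<tau>m(1) in \<open>auto simp: u_def v_def\<close>)
  have "power_arc c (- \<alpha>2) m2 T (\<lambda>t. y2 (t - m2)) (\<lambda>t. z2 (t - m2))"
    using power_arc_translate[OF arcs(3), of m2] by (simp add: \<tau>m(2))
  then have 4: "power_arc c (- \<alpha>2) m2 T u v"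
    by (rule power_arc_cong) (use ord arcs in \<open>auto simp: u_def v_def\<close>)
  have ext: "u \<in> extensional {0..T}" by (simp add: u_def)
  note ps = positive_solution_of_power_arcs[OF \<tau> a ext power_arc_join[OF 1 2] power_arc_join[OF 3 4]]
  have "T - m2 = m2 - \<tau>" by (simp add: \<tau>m(2))
  then have "u 0 = u T" "v 0 = v T" using ord m by (auto simp: u_def v_def)
  then have "periodic_solution T a (2 * c - 1) u"
    using ps \<tau> ord by (simp add: periodic_solution_def)
  then show ?thesis by blast
qed

lemma stepwise_integral:
  assumes W: "stepwise_weight \<alpha>1 \<alpha>2 \<tau> T a"
  shows "(LINT t:{0..T}|lebesgue. a t) = \<alpha>1 * \<tau> - \<alpha>2 * (T - \<tau>)"
proof -
  note \<tau> = stepwise_weightD(1,2)[OF W] and pos = stepwise_weightD(3,4)[OF W]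
    and a = stepwise_weightD(5,6)[OF W]
  have 1: "a absolutely_integrable_on {0..\<tau>}" "(a has_integral \<alpha>1 * \<tau>) {0..\<tau>}"
  proof -
    have eq: "a t = \<alpha>1" if "t \<in> {0..\<tau>} - {\<tau>}" for t using a(1) that by auto
    have "(\<lambda>_. \<alpha>1) absolutely_integrable_on {0..\<tau>}"
      by (intro absolutely_integrable_continuous_real continuous_intros)
    then show "a absolutely_integrable_on {0..\<tau>}"
      by (rule absolutely_integrable_spike[where S = "{\<tau>}"]) (use eq in auto)
    have "((\<lambda>_. \<alpha>1) has_integral \<alpha>1 * \<tau>) {0..\<tau>}"
      using has_integral_const_real[of \<alpha>1 0 \<tau>] \<tau> by (simp add: mult.commute)
    then show "(a has_integral \<alpha>1 * \<tau>) {0..\<tau>}"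
      by (rule has_integral_spike[where S = "{\<tau>}", rotated 2]) (use eq in auto)
  qed
  have 2: "a absolutely_integrable_on {\<tau>..T}" "(a has_integral - \<alpha>2 * (T - \<tau>)) {\<tau>..T}"
  proof -
    have eq: "a t = - \<alpha>2" if "t \<in> {\<tau>..T} - {T}" for t using a(2) that by auto
    have "(\<lambda>_. - \<alpha>2) absolutely_integrable_on {\<tau>..T}"
      by (intro absolutely_integrable_continuous_real continuous_intros)
    then show "a absolutely_integrable_on {\<tau>..T}"
      by (rule absolutely_integrable_spike[where S = "{T}"]) (use eq in auto)
    have "((\<lambda>_. - \<alpha>2) has_integral - \<alpha>2 * (T - \<tau>)) {\<tau>..T}"
      using has_integral_const_real[of "- \<alpha>2" \<tau> T] \<tau> by (simp add: mult.commute)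
    then show "(a has_integral - \<alpha>2 * (T - \<tau>)) {\<tau>..T}"
      by (rule has_integral_spike[where S = "{T}", rotated 2]) (use eq in auto)
  qed
  have "{0..T} = {0..\<tau>} \<union> {\<tau>..T}" using \<tau> by auto
  then have "a absolutely_integrable_on {0..T}" using 1(1) 2(1) by (simp add: set_integrable_Un)
  then have "(LINT t:{0..T}|lebesgue. a t) = integral {0..T} a"
    by (rule set_lebesgue_integral_eq_integral)
  also have "\<dots> = \<alpha>1 * \<tau> + - \<alpha>2 * (T - \<tau>)"
    using has_integral_combine[OF _ _ 1(2) 2(2)] \<tau> by (intro integral_unique) auto
  finally show ?thesis by simp
qed

theorem theorem1p1:
  fixes T \<tau> a_plus a_minus \<gamma> :: real and a :: "real \<Rightarrow> real"
  assumes "0 < \<tau>" and "\<tau> < T"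
    and "a_plus > 0" and "a_minus > 0"
    and "\<And>t. t \<in> {0..<\<tau>} \<Longrightarrow> a t = a_plus"
    and "\<And>t. t \<in> {\<tau>..<T} \<Longrightarrow> a t = - a_minus"
    and "\<gamma> \<in> {..-3} \<union> {1<..}"
  shows "(\<exists>\<^sub>\<le>\<^sub>1 u. neumann_solution T a \<gamma> u) \<and>
         (\<exists>\<^sub>\<le>\<^sub>1 u. periodic_solution T a \<gamma> u) \<and>
         ((\<exists>!u. neumann_solution T a \<gamma> u) \<longleftrightarrow> \<gamma> * (LINT t:{0..T}|lebesgue. a t) < 0) \<and>
         ((\<exists>!u. periodic_solution T a \<gamma> u) \<longleftrightarrow> \<gamma> * (LINT t:{0..T}|lebesgue. a t) < 0)"
proof -
  have W: "stepwise_weight a_plus a_minus \<tau> T a"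
    using assms(1-6) by (simp add: stepwise_weight_def)
  note \<tau> = assms(1,2) and pos = assms(3,4)
  define c where "c = (\<gamma> + 1) / 2"
  have \<gamma>: "\<gamma> = 2 * c - 1" by (simp add: c_def add_divide_distrib distrib_left)
  have c: "c \<le> -1 \<or> c > 1" using assms(7) by (auto simp: c_def)
  then have c': "c < 0 \<or> c > 1" and "c \<noteq> 0" by auto
  have l: "T - \<tau> > 0" "\<tau> / 2 > 0" "(T - \<tau>) / 2 > 0" using \<tau> by auto
  define A where "A = a_plus * \<tau> - a_minus * (T - \<tau>)"
  have I: "(LINT t:{0..T}|lebesgue. a t) = A"
    unfolding A_def by (rule stepwise_integral[OF W])
  have int: "\<gamma> * (LINT t:{0..T}|lebesgue. a t) < 0 \<longleftrightarrow> c * A < 0"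
    unfolding I unfolding \<gamma>
    using c by (auto simp: mult_less_0_iff)
  have half: "c * (a_plus * (\<tau> / 2) - a_minus * ((T - \<tau>) / 2)) < 0 \<longleftrightarrow> c * A < 0"
  proof -
    have h: "c * (a_plus * (\<tau> / 2) - a_minus * ((T - \<tau>) / 2)) = c * A / 2"
      by (simp add: A_def algebra_simps diff_divide_distrib add_divide_distrib)
    show ?thesis unfolding h by simp
  qed
  have N1: "u = w" if "neumann_solution T a \<gamma> u" "neumann_solution T a \<gamma> w" for u w
    using neumann_solution_unique[OF that[unfolded \<gamma>] W c'] .
  have P1: "u = w" if "periodic_solution T a \<gamma> u" "periodic_solution T a \<gamma> w" for u w
    using periodic_solution_unique[OF that[unfolded \<gamma>] W c'] .
  have N2: "(\<exists>u. neumann_solution T a \<gamma> u) \<longleftrightarrow> c * A < 0"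
  proof
    assume "\<exists>u. neumann_solution T a \<gamma> u"
    then obtain u where "neumann_solution T a (2 * c - 1) u" by (auto simp: \<gamma>)
    from junction_sign[OF neumann_solution_imp_junction[OF this W] pos \<tau>(1) l(1) c']
    show "c * A < 0" by (simp add: A_def)
  next
    assume "c * A < 0"
    then show "\<exists>u. neumann_solution T a \<gamma> u"
      using junction_exists[OF pos \<tau>(1) l(1) c] neumann_solution_exists[OF _ W]
      unfolding A_def \<gamma> by metis
  qed
  have P2: "(\<exists>u. periodic_solution T a \<gamma> u) \<longleftrightarrow> c * A < 0"
  proof
    assume "\<exists>u. periodic_solution T a \<gamma> u"
    then obtain u where "periodic_solution T a (2 * c - 1) u" by (auto simp: \<gamma>)
    from junction_sign[OF periodic_solution_symmetric(3)[OF this W \<open>c \<noteq> 0\<close>] pos l(2,3) c']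
    show "c * A < 0" by (simp only: half)
  next
    assume "c * A < 0"
    then show "\<exists>u. periodic_solution T a \<gamma> u"
      using junction_exists[OF pos l(2,3) c] periodic_solution_exists[OF _ W]
      unfolding half[symmetric] \<gamma> by metis
  qed
  show ?thesis
    unfolding Uniq_def int N2[symmetric] using N1 P1 N2 P2 by blast
qed

end
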